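(* Let $\star$ be a nondegenerate star product with separation of variables on an open subset $U\subset\mathbb{C}^m$, let $u$ be an admissible function on $U\times\mathbb{C}^{0|d}$ (with respect to $\star$), and let $\ast$ be the product associated with the pair $(\star,u)$. There exists a unique canonical formal Berezin supertrace density $$\mu=\rho\,dz\,d\bar z\,d\theta\,d\bar\theta$$ for the product $\ast$, where $\rho\in C^\infty(U\times\mathbb{C}^{0|d})[\nu^{-1},\nu]]$ and $dz\,d\bar z$ is a Lebesgue measure on $U$, such that the canonical supertrace functional $\sigma$ of the product $\ast$ is given by the Berezin integral $$\sigma(f)=\int f\,\mu$$ for every formal function $f$ with compact support on $U\times\mathbb{C}^{0|d}$.
   Context: Notation. $U$ has coordinates $z^k,\bar z^l$, and $\mathbb{C}^{0|d}$ has anticommuting odd coordinates $\theta^\alpha,\bar\theta^\beta$, $1\le\alpha,\beta\le d$. $[d]=\{1,\dots,d\}$; for $I=\{\alpha_1<\dots<\alpha_k\}\subset[d]$, $|I|=k$ and $\theta^I=\theta^{\alpha_1}\cdots\theta^{\alpha_k}$, similarly $\bar\theta^J$. Functions on $U\times\mathbb{C}^{0|d}$ are $f=f_{IJ}\theta^I\bar\theta^J$ with $f_{IJ}\in C^\infty(U)$ complex valued; repeated upper and lower indices are summed. $\mathcal{A}[\nu^{-1},\nu]]$ denotes formal Laurent series in $\nu$ with finite principal part and coefficients in $\mathcal{A}$; formal functions are such series. A formal function has compact support if each coefficient of its $\nu$-expansion has compact support in $U$ (no common compact support required). Star product with separation of variables on $U$: an associative, $\nu$-linear, $\nu$-adically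 continuous product $f\star g=\sum_{r\ge0}\nu^rC_r(f,g)$ on $C^\infty(U)[\nu^{-1},\nu]]$ with unit $1$, bidifferential $C_r$, $C_0(f,g)=fg$, such that $a\star f=af$ and $f\star b=fb$ for all locally defined holomorphic $a$ and antiholomorphic $b$. Then $C_1(f,g)=g^{lk}\frac{\partial f}{\partial\bar z^l}\frac{\partial g}{\partial z^k}$; $\star$ is nondegenerate if $(g^{lk})$ is invertible at every point, and then, with $(g_{kl})$ the inverse matrix, $\omega_{-1}=ig_{kl}dz^k\wedge d\bar z^l$. Canonical trace density of $\star$: the formal density $\mu_\star=\frac{1}{m!\,\nu^m}(\omega_{-1})^me^{\varkappa}$, with $\varkappa=\nu\varkappa_1+\nu^2\varkappa_2+\ldots$ a formal function on $U$, such that $\int f\star g\,\mu_\star=\int g\star f\,\mu_\star$ whenever $f$ or $g$ has compact support, and determined on each contractible open subset $W\subset U$ by the normalization $\frac{d}{d\nu}\int_Wf\,\mu_\star=\int_W\delta(f)\,\mu_\star$ for every compactly supported formal $f$ on $W$, where $\delta=\frac{d}{d\nu}+A$ is a derivation of $\star$ on $W$ with $A=\nu^{-1}A_{-1}+A_0+\nu A_1+\ldots$ a formal differential operator (such $\delta$ exists and such $\mu_\star$ exists and is unique). Admissible functions and associated products: an even formal function $u=u_{PQ}\theta^P\bar\theta^Q$ with $u_{\emptyset\emptyset}=1$ is admissible with respect to $\star$ if there is a matrix $(v^{QP})$ with entries in $C^\infty(U)[\nu^{-1},\nu]]$ such that $u_{PQ}\star v^{QK}=\delta_P^K$ and $v^{LP}\star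 u_{PQ}=\delta^L_Q$. The product associated with $(\star,u)$ is $$f\ast g=u^{-1}\big((uf)_{KQ}\star v^{QP}\star(ug)_{PL}\big)\theta^K\bar\theta^L,$$ where $uf=(uf)_{KL}\theta^K\bar\theta^L$. Canonical supertrace functional of $\ast$: every formal $f$ is uniquely of the form $f=u^{-1}(f_K^I\star u_{IL})\theta^K\bar\theta^L$ with $f_K^I\in C^\infty(U)[\nu^{-1},\nu]]$, and for $f$ of compact support $\sigma(f)=\sum_I\int_U(-1)^{|I|}f_I^I\,\mu_\star$. Berezin integral: $\int f_{IJ}\theta^I\bar\theta^J\,d\theta\,d\bar\theta=f_{[d][d]}$; thus $\int f\,\mu=\int_U(f\rho)_{[d][d]}\,dz\,d\bar z$. A Berezin density $\mu$ is a supertrace density for $\ast$ if $\int(f\ast g)\mu=(-1)^{|f||g|}\int(g\ast f)\mu$ for homogeneous $f,g$, one of which has compact support. *)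

theory Defs
  imports
    "HOL-Analysis.Analysis"
    "HOL-Computational_Algebra.Formal_Laurent_Series"
    "HOL-Library.Function_Algebras"
begin

section \<open>Smooth functions, Wirtinger derivatives, differential operators\<close>

fun iter_deriv ::
  "'a::real_normed_vector list \<Rightarrow> ('a \<Rightarrow> complex) \<Rightarrow> 'a \<Rightarrow> complex" where
  "iter_deriv [] f = f"
| "iter_deriv (v # vs) f = (\<lambda>x. frechet_derivative (iter_deriv vs f) (at x) v)"

text \<open>
  \<open>C\<^sup>\<infinity>\<close> in the real sense; only used for open \<open>W\<close>.  The condition involves the germs of
  \<open>f\<close> at points of \<open>W\<close> only, so the values of \<open>f\<close> outside \<open>W\<close> are irrelevant.
\<close>

definition smooth_on :: "'a::real_normed_vector set \<Rightarrow> ('a \<Rightarrow> complex) \<Rightarrow> bool" where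
  "smooth_on W f \<longleftrightarrow> (\<forall>vs. \<forall>x\<in>W. iter_deriv vs f differentiable (at x))"

definition d_z :: "'m::finite \<Rightarrow> (complex^'m \<Rightarrow> complex) \<Rightarrow> complex^'m \<Rightarrow> complex" where
  "d_z k f x = (frechet_derivative f (at x) (axis k 1)
               - \<i> * frechet_derivative f (at x) (axis k \<i>)) / 2"

definition d_zbar :: "'m::finite \<Rightarrow> (complex^'m \<Rightarrow> complex) \<Rightarrow> complex^'m \<Rightarrow> complex" where
  "d_zbar l f x = (frechet_derivative f (at x) (axis l 1)
                  + \<i> * frechet_derivative f (at x) (axis l \<i>)) / 2"

definition holo_on :: "(complex^'m::finite) set \<Rightarrow> (complex^'m \<Rightarrow> complex) \<Rightarrow> bool" where
  "holo_on W a \<longleftrightarrow> smooth_on W a \<and> (\<forall>l. \<forall>x\<in>W. d_zbar l a x = 0)"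

definition antiholo_on :: "(complex^'m::finite) set \<Rightarrow> (complex^'m \<Rightarrow> complex) \<Rightarrow> bool" where
  "antiholo_on W b \<longleftrightarrow> smooth_on W b \<and> (\<forall>k. \<forall>x\<in>W. d_z k b x = 0)"

definition diff_op ::
  "'a::euclidean_space set \<Rightarrow> (('a \<Rightarrow> complex) \<Rightarrow> 'a \<Rightarrow> complex) \<Rightarrow> bool" where
  "diff_op W D \<longleftrightarrow>
     (\<exists>S c. finite S \<and> (\<forall>vs\<in>S. set vs \<subseteq> Basis \<and> smooth_on W (c vs)) \<and>
        (\<forall>f. smooth_on W f \<longrightarrow>
           (\<forall>x\<in>W. D f x = (\<Sum>vs\<in>S. c vs x * iter_deriv vs f x))))"

text \<open>
  A bidifferential operator on \<open>U\<close> acts on functions defined on any open subset of \<open>U\<close>.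
  This action is part of the definition: the same coefficients are used for all open
  \<open>W \<subseteq> U\<close> and all functions smooth on \<open>W\<close>.  Products of locally defined functions therefore
  make sense without choosing extensions to \<open>U\<close>.
\<close>

definition bidiff_op ::
  "'a::euclidean_space set \<Rightarrow> (('a \<Rightarrow> complex) \<Rightarrow> ('a \<Rightarrow> complex) \<Rightarrow> 'a \<Rightarrow> complex) \<Rightarrow> bool" where
  "bidiff_op U B \<longleftrightarrow>
     (\<exists>S c. finite S \<and>
        (\<forall>(vs, ws)\<in>S. set vs \<subseteq> Basis \<and> set ws \<subseteq> Basis \<and> smooth_on U (c vs ws)) \<and>
        (\<forall>W f g. open W \<and> W \<subseteq> U \<and> smooth_on W f \<and> smooth_on W g \<longrightarrow>
           (\<forall>x\<in>W. B f g x = (\<Sum>(vs, ws)\<in>S. c vs ws x * iter_deriv vs f x * iter_deriv ws g x))))"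

section \<open>Formal functions\<close>

text \<open>
  The Laurent variable of \<^typ>\<open>('a \<Rightarrow> complex) fls\<close> is \<open>\<nu>\<close>; the coefficients form a ring under the
  pointwise operations.  Functions on \<open>W\<close> are represented by total functions vanishing outside
  \<open>W\<close>, so that equality of formal functions on \<open>W\<close> is plain equality.
\<close>

type_synonym 'm formal = "(complex^'m \<Rightarrow> complex) fls"

definition on_set :: "'a set \<Rightarrow> ('a \<Rightarrow> complex) \<Rightarrow> 'a \<Rightarrow> complex" where
  "on_set W f = (\<lambda>x. if x \<in> W then f x else 0)"

definition formal_funs :: "(complex^'m::finite) set \<Rightarrow> 'm formal set" where
  "formal_funs W = {f. \<forall>n. smooth_on W (fls_nth f n) \<and> (\<forall>x. x \<notin> W \<longrightarrow> fls_nth f n x = 0)}"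

definition formal_of :: "(complex^'m::finite) set \<Rightarrow> (complex^'m \<Rightarrow> complex) \<Rightarrow> 'm formal" where
  "formal_of W f = fls_const (on_set W f)"

abbreviation formal_one :: "(complex^'m::finite) set \<Rightarrow> 'm formal" where
  "formal_one W \<equiv> formal_of W (\<lambda>x. 1)"

definition compact_support :: "(complex^'m::finite) set \<Rightarrow> 'm formal \<Rightarrow> bool" where
  "compact_support W f \<longleftrightarrow>
     (\<forall>n. \<exists>K. compact K \<and> K \<subseteq> W \<and> (\<forall>x. x \<notin> K \<longrightarrow> fls_nth f n x = 0))"

definition formal_integral ::
  "(complex^'m::finite) measure \<Rightarrow> (complex^'m) set \<Rightarrow> 'm formal \<Rightarrow> complex fls" where
  "formal_integral M W h = Abs_fls (\<lambda>n. LINT x:W|M. fls_nth h n x)"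

text \<open>The exponential of a formal function with only positive powers of \<open>\<nu>\<close>, computed pointwise.\<close>

definition formal_exp :: "(complex^'m::finite) set \<Rightarrow> 'm formal \<Rightarrow> 'm formal" where
  "formal_exp W \<kappa> = fps_to_fls (Abs_fps (\<lambda>n. on_set W (\<lambda>x.
     fps_nth (fps_compose (fps_exp 1) (Abs_fps (\<lambda>j. fls_nth \<kappa> (int j) x))) n)))"

text \<open>
  Action of \<open>A = \<nu>\<^sup>-\<^sup>1 A\<^sub>-\<^sub>1 + A\<^sub>0 + \<nu> A\<^sub>1 + \<dots>\<close>: the coefficient at \<open>\<nu>\<^sup>n\<close> is the sum of
  \<open>A\<^sub>k (f\<^sub>i)\<close> over \<open>i + k = n\<close>, \<open>k \<ge> -1\<close>, a finite sum since \<open>f\<close> has finite principal part.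
\<close>

definition formal_op_apply ::
  "(complex^'m::finite) set \<Rightarrow> (int \<Rightarrow> (complex^'m \<Rightarrow> complex) \<Rightarrow> complex^'m \<Rightarrow> complex) \<Rightarrow>
   'm formal \<Rightarrow> 'm formal" where
  "formal_op_apply W A f = Abs_fls (\<lambda>n. on_set W (\<lambda>x.
     \<Sum>i\<in>{fls_subdegree f..n + 1}. A (n - i) (fls_nth f i) x))"

section \<open>Star products with separation of variables\<close>

type_synonym 'm cochains =
  "nat \<Rightarrow> (complex^'m \<Rightarrow> complex) \<Rightarrow> (complex^'m \<Rightarrow> complex) \<Rightarrow> complex^'m \<Rightarrow> complex"

text \<open>
  The \<open>\<nu>\<close>-linear, \<open>\<nu>\<close>-adically continuous extension of \<open>\<Sum>\<^sub>r \<nu>\<^sup>r C\<^sub>r\<close> to formal functions on \<open>W\<close>: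
  the coefficient at \<open>\<nu>\<^sup>n\<close> is the sum of \<open>C\<^sub>r (f\<^sub>i, g\<^sub>j)\<close> over \<open>i + j + r = n\<close>, \<open>r \<ge> 0\<close>.
\<close>

definition star ::
  "(complex^'m::finite) set \<Rightarrow> 'm cochains \<Rightarrow> 'm formal \<Rightarrow> 'm formal \<Rightarrow> 'm formal" where
  "star W C f g = Abs_fls (\<lambda>n. on_set W (\<lambda>x.
     \<Sum>i\<in>{fls_subdegree f..n - fls_subdegree g}. \<Sum>j\<in>{fls_subdegree g..n - i}.
       C (nat (n - i - j)) (fls_nth f i) (fls_nth g j) x))"

definition star_product_sep :: "(complex^'m::finite) set \<Rightarrow> 'm cochains \<Rightarrow> bool" where
  "star_product_sep U C \<longleftrightarrow>
     (\<forall>r. bidiff_op U (C r)) \<and>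
     (\<forall>f g. smooth_on U f \<and> smooth_on U g \<longrightarrow> (\<forall>x\<in>U. C 0 f g x = f x * g x)) \<and>
     (\<forall>f\<in>formal_funs U. star U C (formal_one U) f = f \<and> star U C f (formal_one U) = f) \<and>
     (\<forall>f\<in>formal_funs U. \<forall>g\<in>formal_funs U. \<forall>h\<in>formal_funs U.
        star U C (star U C f g) h = star U C f (star U C g h)) \<and>
     (\<forall>W a. open W \<and> W \<subseteq> U \<and> holo_on W a \<longrightarrow>
        (\<forall>f\<in>formal_funs W. star W C (formal_of W a) f = formal_of W a * f)) \<and>
     (\<forall>W b. open W \<and> W \<subseteq> U \<and> antiholo_on W b \<longrightarrow>
        (\<forall>f\<in>formal_funs W. star W C f (formal_of W b) = f * formal_of W b))"

text \<open>\<open>G x $ l $ k\<close> is \<open>g\<^sup>l\<^sup>k\<close> at \<open>x\<close>, the first index belonging to \<open>\<partial>/\<partial>\<close>zbar.\<close>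

definition C1_tensor ::
  "(complex^'m::finite) set \<Rightarrow> 'm cochains \<Rightarrow> (complex^'m \<Rightarrow> complex^'m^'m) \<Rightarrow> bool" where
  "C1_tensor U C G \<longleftrightarrow>
     (\<forall>f h. smooth_on U f \<and> smooth_on U h \<longrightarrow>
        (\<forall>x\<in>U. C 1 f h x = (\<Sum>l\<in>UNIV. \<Sum>k\<in>UNIV. G x $ l $ k * d_zbar l f x * d_z k h x)))"

definition nondegenerate :: "(complex^'m::finite) set \<Rightarrow> 'm cochains \<Rightarrow> bool" where
  "nondegenerate U C \<longleftrightarrow> (\<exists>G. C1_tensor U C G \<and> (\<forall>x\<in>U. invertible (G x)))"

section \<open>The canonical trace density\<close>

text \<open>
  Densities on \<open>U\<close> are given by their formal function relative to \<^const>\<open>lborel\<close>.  Since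
  \<open>i dz \<and> dzbar = 2 dx \<and> dy\<close>, the top form \<open>\<omega>\<^sub>-\<^sub>1\<^sup>m / m!\<close> with
  \<open>\<omega>\<^sub>-\<^sub>1 = i g\<^sub>k\<^sub>l dz\<^sup>k \<and> dzbar\<^sup>l\<close> equals \<open>2\<^sup>m det (g\<^sub>k\<^sub>l)\<close> times Lebesgue measure.
\<close>

definition trace_density_form ::
  "(complex^'m::finite) set \<Rightarrow> 'm cochains \<Rightarrow> 'm formal \<Rightarrow> bool" where
  "trace_density_form U C dens \<longleftrightarrow>
     (\<exists>G \<kappa>. C1_tensor U C G \<and> \<kappa> \<in> formal_funs U \<and> (\<forall>n\<le>0. fls_nth \<kappa> n = 0) \<and>
        dens = fls_X_intpow (- int CARD('m))
               * formal_of U (\<lambda>x. 2 ^ CARD('m) * det (matrix_inv (G x)))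
               * formal_exp U \<kappa>)"

definition trace_property ::
  "(complex^'m::finite) set \<Rightarrow> 'm cochains \<Rightarrow> 'm formal \<Rightarrow> bool" where
  "trace_property U C dens \<longleftrightarrow>
     (\<forall>f\<in>formal_funs U. \<forall>g\<in>formal_funs U. compact_support U f \<or> compact_support U g \<longrightarrow>
        formal_integral lborel U (star U C f g * dens)
          = formal_integral lborel U (star U C g f * dens))"

definition nu_derivation ::
  "(complex^'m::finite) set \<Rightarrow> 'm cochains \<Rightarrow> ('m formal \<Rightarrow> 'm formal) \<Rightarrow> bool" where
  "nu_derivation W C \<delta> \<longleftrightarrow>
     (\<exists>A. (\<forall>k\<ge>-1. diff_op W (A k)) \<and>
        (\<forall>f\<in>formal_funs W. \<delta> f = fls_deriv f + formal_op_apply W A f)) \<and>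
     (\<forall>f\<in>formal_funs W. \<forall>g\<in>formal_funs W.
        \<delta> (star W C f g) = star W C (\<delta> f) g + star W C f (\<delta> g))"

definition canonical_trace_density ::
  "(complex^'m::finite) set \<Rightarrow> 'm cochains \<Rightarrow> 'm formal \<Rightarrow> bool" where
  "canonical_trace_density U C dens \<longleftrightarrow>
     trace_density_form U C dens \<and> trace_property U C dens \<and>
     (\<forall>W. open W \<and> W \<subseteq> U \<and> contractible W \<longrightarrow>
        (\<exists>\<delta>. nu_derivation W C \<delta> \<and>
           (\<forall>f\<in>formal_funs W. compact_support W f \<longrightarrow>
              fls_deriv (formal_integral lborel W (f * dens))
                = formal_integral lborel W (\<delta> f * dens))))"

section \<open>Superfunctions\<close>

text \<open>
  \<open>f I J\<close> is the coefficient of \<open>\<theta>\<^sup>I \<theta>bar\<^sup>J\<close>, with \<open>I, J \<subseteq> {1..d}\<close> and both monomials in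
  increasing order.  The same type is used for matrices indexed by subsets of \<open>{1..d}\<close>.
\<close>

type_synonym 'm superfun = "nat set \<Rightarrow> nat set \<Rightarrow> 'm formal"

definition superfuns :: "(complex^'m::finite) set \<Rightarrow> nat \<Rightarrow> 'm superfun set" where
  "superfuns U d = {f. \<forall>I J. f I J \<in> formal_funs U \<and>
                        (\<not> (I \<subseteq> {1..d} \<and> J \<subseteq> {1..d}) \<longrightarrow> f I J = 0)}"

text \<open>\<open>\<theta>\<^sup>I \<theta>\<^sup>K = (-1) ^ inversions I K * \<theta>\<^bsup>I \<union> K\<^esup>\<close> for disjoint \<open>I\<close> and \<open>K\<close>.\<close>

definition inversions :: "nat set \<Rightarrow> nat set \<Rightarrow> nat" where
  "inversions I K = card {(a, b) \<in> I \<times> K. b < a}"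

text \<open>
  The supercommutative product: in \<open>\<theta>\<^sup>I \<theta>bar\<^sup>J \<theta>\<^bsup>A - I\<^esup> \<theta>bar\<^bsup>B - J\<^esup>\<close> moving \<open>\<theta>\<^bsup>A - I\<^esup>\<close> past
  \<open>\<theta>bar\<^sup>J\<close> contributes the factor \<open>(-1) ^ (card J * card (A - I))\<close>.
\<close>

definition super_mult :: "'m::finite superfun \<Rightarrow> 'm superfun \<Rightarrow> 'm superfun" where
  "super_mult f g = (\<lambda>A B. \<Sum>I\<in>Pow A. \<Sum>J\<in>Pow B.
     (-1) ^ (card J * card (A - I) + inversions I (A - I) + inversions J (B - J))
       * f I J * g (A - I) (B - J))"

definition super_one :: "(complex^'m::finite) set \<Rightarrow> 'm superfun" where
  "super_one U = (\<lambda>I J. if I = {} \<and> J = {} then formal_one U else 0)"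

definition super_inv :: "(complex^'m::finite) set \<Rightarrow> nat \<Rightarrow> 'm superfun \<Rightarrow> 'm superfun" where
  "super_inv U d u = (THE w. w \<in> superfuns U d \<and> super_mult u w = super_one U)"

definition homogeneous :: "nat \<Rightarrow> 'm::finite superfun \<Rightarrow> bool" where
  "homogeneous p f \<longleftrightarrow> (\<forall>I J. f I J \<noteq> 0 \<longrightarrow> (card I + card J) mod 2 = p mod 2)"

definition super_compact_support :: "(complex^'m::finite) set \<Rightarrow> 'm superfun \<Rightarrow> bool" where
  "super_compact_support U f \<longleftrightarrow> (\<forall>I J. compact_support U (f I J))"

section \<open>Admissible functions and the associated product\<close>

definition star_matrix_mult ::
  "(complex^'m::finite) set \<Rightarrow> 'm cochains \<Rightarrow> nat \<Rightarrow> 'm superfun \<Rightarrow> 'm superfun \<Rightarrow> 'm superfun" where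
  "star_matrix_mult U C d M N = (\<lambda>K L. \<Sum>Q\<in>Pow {1..d}. star U C (M K Q) (N Q L))"

definition matrix_one :: "(complex^'m::finite) set \<Rightarrow> nat \<Rightarrow> 'm superfun" where
  "matrix_one U d = (\<lambda>P K. if P = K \<and> P \<subseteq> {1..d} then formal_one U else 0)"

definition is_star_inverse ::
  "(complex^'m::finite) set \<Rightarrow> 'm cochains \<Rightarrow> nat \<Rightarrow> 'm superfun \<Rightarrow> 'm superfun \<Rightarrow> bool" where
  "is_star_inverse U C d u v \<longleftrightarrow> v \<in> superfuns U d \<and>
     star_matrix_mult U C d u v = matrix_one U d \<and> star_matrix_mult U C d v u = matrix_one U d"

definition admissible ::
  "(complex^'m::finite) set \<Rightarrow> 'm cochains \<Rightarrow> nat \<Rightarrow> 'm superfun \<Rightarrow> bool" where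
  "admissible U C d u \<longleftrightarrow> u \<in> superfuns U d \<and> homogeneous 0 u \<and> u {} {} = formal_one U \<and>
     (\<exists>v. is_star_inverse U C d u v)"

definition assoc_product ::
  "(complex^'m::finite) set \<Rightarrow> 'm cochains \<Rightarrow> nat \<Rightarrow> 'm superfun \<Rightarrow>
   'm superfun \<Rightarrow> 'm superfun \<Rightarrow> 'm superfun" where
  "assoc_product U C d u f g =
     (let v = (THE v. is_star_inverse U C d u v) in
      super_mult (super_inv U d u)
        (star_matrix_mult U C d (star_matrix_mult U C d (super_mult u f) v) (super_mult u g)))"

section \<open>The canonical supertrace and Berezin densities\<close>

text \<open>\<open>matrix_coeffs U C d u f K I\<close> is \<open>f\<^sub>K\<^sup>I\<close>.\<close>

definition matrix_coeffs ::
  "(complex^'m::finite) set \<Rightarrow> 'm cochains \<Rightarrow> nat \<Rightarrow> 'm superfun \<Rightarrow> 'm superfun \<Rightarrow> 'm superfun" where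
  "matrix_coeffs U C d u f =
     (THE F. F \<in> superfuns U d \<and> f = super_mult (super_inv U d u) (star_matrix_mult U C d F u))"

definition canonical_supertrace ::
  "(complex^'m::finite) set \<Rightarrow> 'm cochains \<Rightarrow> nat \<Rightarrow> 'm superfun \<Rightarrow> 'm formal \<Rightarrow>
   'm superfun \<Rightarrow> complex fls" where
  "canonical_supertrace U C d u dens f =
     (\<Sum>I\<in>Pow {1..d}. (-1) ^ card I * formal_integral lborel U (matrix_coeffs U C d u f I I * dens))"

definition is_lebesgue :: "'a::euclidean_space measure \<Rightarrow> bool" where
  "is_lebesgue M \<longleftrightarrow> (\<exists>c>0. M = scale_measure (ennreal c) lborel)"

text \<open>
  \<open>\<integral> f \<mu>\<close> for \<open>\<mu> = \<rho> dz dzbar d\<theta> d\<theta>bar\<close>, where \<open>M\<close> is the chosen Lebesgue measure \<open>dz dzbar\<close>.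
\<close>

definition berezin_integral ::
  "(complex^'m::finite) measure \<Rightarrow> (complex^'m) set \<Rightarrow> nat \<Rightarrow> 'm superfun \<Rightarrow> 'm superfun \<Rightarrow>
   complex fls" where
  "berezin_integral M U d f \<rho> = formal_integral M U (super_mult f \<rho> {1..d} {1..d})"

definition supertrace_density ::
  "(complex^'m::finite) measure \<Rightarrow> (complex^'m) set \<Rightarrow> 'm cochains \<Rightarrow> nat \<Rightarrow> 'm superfun \<Rightarrow>
   'm superfun \<Rightarrow> bool" where
  "supertrace_density M U C d u \<rho> \<longleftrightarrow>
     (\<forall>f\<in>superfuns U d. \<forall>g\<in>superfuns U d. \<forall>p q.
        homogeneous p f \<and> homogeneous q g \<and> (super_compact_support U f \<or> super_compact_support U g) \<longrightarrow>
        berezin_integral M U d (assoc_product U C d u f g) \<rho>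
          = (-1) ^ (p * q) * berezin_integral M U d (assoc_product U C d u g f) \<rho>)"

end

theory Submission
  imports Defs
begin

text \<open>
  For a superfunction \<open>f\<close>, the matrix \<open>(f\<^sub>K\<^sup>I)\<close> of its coefficients is \<open>(u f) \<star> v\<close>, where \<open>v\<close> is the
  inverse of the matrix \<open>u\<close> over the algebra of \<open>\<star>\<close>.  Hence \<open>\<sigma>(f)\<close> is a signed sum of integrals
  \<open>\<integral> (u f)\<^sub>I\<^sub>J \<star> v\<^sup>J\<^sup>I \<mu>\<^sub>\<star>\<close> of components of \<open>u f\<close>, multiplied in the sense of \<open>\<star>\<close> by fixed functions.

  \<^emph>\<open>Existence.\<close>  The product \<open>\<star>\<close> is a formal series of bidifferential operators, so integration by
  parts moves all derivatives off the compactly supported first factor: for every formal \<open>g\<close> there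
  is a formal \<open>w\<close> with \<open>\<integral> (\<phi> \<star> g) \<mu>\<^sub>\<star> = \<integral> \<phi> w dz dzbar\<close> for all compactly supported \<open>\<phi>\<close>
  (\<open>ex_star_adjoint\<close>).  This makes \<open>\<sigma>(f)\<close> the integral of a linear combination of the components of
  \<open>u f\<close> with ordinary functions as coefficients.  The coefficients assemble into a superfunction
  \<open>W\<close> such that the combination is the top component of \<open>(u f) W\<close>.  The Grassmann product is
  associative and \<open>u\<close> is even, so \<open>(u f) W = f (u W)\<close> and \<open>\<rho> = u W\<close> is a density for \<open>\<sigma>\<close>
  (\<open>ex_berezin_density\<close>).  That \<open>w\<close> is smooth requires \<open>\<mu>\<^sub>\<star>\<close> to be smooth; this follows from its
  form, since the tensor of \<open>C\<^sub>1\<close> is obtained by applying \<open>C\<^sub>1\<close> to coordinate functions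
  (\<open>trace_density_in_formal_funs\<close>).

  \<^emph>\<open>Supertrace property.\<close>  The passage from \<open>f\<close> to its coefficient matrix turns \<open>*\<close> into matrix
  multiplication over the algebra of \<open>\<star>\<close>, and \<open>\<sigma>\<close> into the matrix supertrace followed by the trace
  \<open>\<integral> - \<mu>\<^sub>\<star>\<close>.  Parities are preserved because \<open>u\<close>, and therefore also \<open>v\<close>, is even.  The supertrace
  property is the usual one for matrices with entries in an algebra with a trace
  (\<open>canonical_supertrace_supercommutes\<close>).

  \<^emph>\<open>Uniqueness.\<close>  Pairing with a test function times a monomial determines the component of the
  density at the complementary monomial, by the fundamental lemma of the calculus of variations
  (\<open>berezin_density_unique\<close>).

  The analytic input consists of closure properties of smooth functions, the existence of bump
  functions, and the vanishing of the integral of a derivative of a test function.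
\<close>

section \<open>Calculus of smooth functions\<close>

lemma frechet_derivative_cong_open:
  assumes "open W" "x \<in> W" "\<And>y. y \<in> W \<Longrightarrow> f y = g y"
  shows "frechet_derivative f (at x) = frechet_derivative g (at x)"
proof -
  have "\<And>f'. (f has_derivative f') (at x) \<longleftrightarrow> (g has_derivative f') (at x)"
    using assms by (metis has_derivative_transform_within_open)
  then show ?thesis unfolding frechet_derivative_def by simp
qed

lemma differentiable_cong_open:
  assumes "open W" "x \<in> W" "\<And>y. y \<in> W \<Longrightarrow> f y = g y"
  shows "f differentiable (at x) \<longleftrightarrow> g differentiable (at x)"
  using assms unfolding differentiable_def by (metis has_derivative_transform_within_open)

lemma iter_deriv_cong_open:
  assumes "open W" "\<And>y. y \<in> W \<Longrightarrow> f y = g y" "x \<in> W"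
  shows "iter_deriv vs f x = iter_deriv vs g x"
  using assms(3)
proof (induction vs arbitrary: x)
  case (Cons v vs)
  then show ?case
    using frechet_derivative_cong_open[OF assms(1) Cons.prems, of "iter_deriv vs f" "iter_deriv vs g"]
    by simp
qed (use assms in auto)

lemma smooth_on_cong:
  assumes "open W" "\<And>y. y \<in> W \<Longrightarrow> f y = g y"
  shows "smooth_on W f \<longleftrightarrow> smooth_on W g"
proof -
  have "iter_deriv vs f differentiable (at x) \<longleftrightarrow> iter_deriv vs g differentiable (at x)"
    if "x \<in> W" for vs x
    by (rule differentiable_cong_open[OF assms(1) that]) (use iter_deriv_cong_open assms in blast)
  then show ?thesis unfolding smooth_on_def by simp
qed

lemma iter_deriv_append: "iter_deriv (vs @ ws) f = iter_deriv vs (iter_deriv ws f)"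
  by (induction vs) auto

lemma smooth_on_iter_deriv: "smooth_on W f \<Longrightarrow> smooth_on W (iter_deriv vs f)"
  unfolding smooth_on_def by (metis iter_deriv_append)

lemma smooth_on_differentiable: "smooth_on W f \<Longrightarrow> x \<in> W \<Longrightarrow> f differentiable (at x)"
  unfolding smooth_on_def by (metis iter_deriv.simps(1))

lemma smooth_on_subset: "smooth_on W f \<Longrightarrow> V \<subseteq> W \<Longrightarrow> smooth_on V f"
  unfolding smooth_on_def by blast

lemma smooth_on_continuous_on: "smooth_on W f \<Longrightarrow> continuous_on W f"
  by (meson continuous_at_imp_continuous_on differentiable_imp_continuous_within smooth_on_differentiable)

lemma frechet_derivativeI:
  "(f has_derivative f') (at x) \<Longrightarrow> frechet_derivative f (at x) = f'"
  using frechet_derivative_at by metis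

text \<open>
  Smoothness is coinductive: a class of functions is smooth as soon as its members are
  differentiable and the class is stable under directional derivatives.
\<close>

lemma smooth_on_coinduct:
  assumes "open W" "P f"
    and step: "\<And>g x. P g \<Longrightarrow> x \<in> W \<Longrightarrow> g differentiable (at x)"
      "\<And>g v. P g \<Longrightarrow> \<exists>g'. P g' \<and> (\<forall>x\<in>W. frechet_derivative g (at x) v = g' x)"
  shows "smooth_on W f"
proof -
  have *: "\<exists>g. P g \<and> (\<forall>x\<in>W. iter_deriv vs f x = g x)" for vs
  proof (induction vs)
    case (Cons v vs)
    then obtain g where g: "P g" "\<forall>x\<in>W. iter_deriv vs f x = g x" by blast
    obtain g' where g': "P g'" "\<forall>x\<in>W. frechet_derivative g (at x) v = g' x"
      using step(2)[OF g(1)] by blast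
    show ?case
      using g' g(2) frechet_derivative_cong_open[OF assms(1), of _ "iter_deriv vs f" g]
      by (intro exI[of _ g']) simp
  qed (use assms(2) in auto)
  show ?thesis unfolding smooth_on_def
  proof (intro allI ballI)
    fix vs x assume "x \<in> W"
    obtain g where g: "P g" "\<forall>x\<in>W. iter_deriv vs f x = g x" using * by blast
    show "iter_deriv vs f differentiable (at x)"
      using differentiable_cong_open[OF assms(1) \<open>x \<in> W\<close>, of "iter_deriv vs f" g] g step(1) \<open>x \<in> W\<close>
      by blast
  qed
qed

inductive generated_algebra :: "(('a \<Rightarrow> complex) \<Rightarrow> bool) \<Rightarrow> ('a \<Rightarrow> complex) \<Rightarrow> bool" for G where
  gen: "G f \<Longrightarrow> generated_algebra G f"
| add: "generated_algebra G f \<Longrightarrow> generated_algebra G g \<Longrightarrow> generated_algebra G (\<lambda>x. f x + g x)"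
| mult: "generated_algebra G f \<Longrightarrow> generated_algebra G g \<Longrightarrow> generated_algebra G (\<lambda>x. f x * g x)"

lemma frechet_derivative_mult:
  fixes f g :: "'a::real_normed_vector \<Rightarrow> complex"
  assumes "f differentiable (at x)" "g differentiable (at x)"
  shows "frechet_derivative (\<lambda>x. f x * g x) (at x) v
    = f x * frechet_derivative g (at x) v + frechet_derivative f (at x) v * g x"
proof -
  have "((\<lambda>x. f x * g x) has_derivative
     (\<lambda>v. f x * frechet_derivative g (at x) v + frechet_derivative f (at x) v * g x)) (at x)"
    using assms by (auto intro: has_derivative_mult simp: frechet_derivative_works)
  then show ?thesis by (simp add: frechet_derivativeI)
qed

lemma frechet_derivative_add:
  fixes f g :: "'a::real_normed_vector \<Rightarrow> complex"
  assumes "f differentiable (at x)" "g differentiable (at x)"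
  shows "frechet_derivative (\<lambda>x. f x + g x) (at x) v
    = frechet_derivative f (at x) v + frechet_derivative g (at x) v"
proof -
  have "((\<lambda>x. f x + g x) has_derivative
     (\<lambda>v. frechet_derivative f (at x) v + frechet_derivative g (at x) v)) (at x)"
    using assms by (auto intro: has_derivative_add simp: frechet_derivative_works)
  then show ?thesis by (simp add: frechet_derivativeI)
qed

text \<open>
  By the Leibniz rule it suffices to differentiate the generators, and their derivatives need
  only lie in the algebra that the generators span.
\<close>

lemma smooth_on_generated_algebra:
  assumes "open W" "generated_algebra G f"
    and diff: "\<And>g x. G g \<Longrightarrow> x \<in> W \<Longrightarrow> g differentiable (at x)"
    and deriv: "\<And>g v. G g \<Longrightarrow>
        \<exists>g'. generated_algebra G g' \<and> (\<forall>x\<in>W. frechet_derivative g (at x) v = g' x)"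
  shows "smooth_on W f"
proof -
  have dif: "g differentiable (at x)" if "generated_algebra G g" "x \<in> W" for g x
    using that by (induction) (auto intro: diff)
  show ?thesis
  proof (rule smooth_on_coinduct[where P = "generated_algebra G", OF assms(1,2) dif])
    fix g v assume "generated_algebra G g"
    then show "\<exists>g'. generated_algebra G g' \<and> (\<forall>x\<in>W. frechet_derivative g (at x) v = g' x)"
    proof induction
      case (gen f)
      then show ?case by (rule deriv)
    next
      case (add f g)
      then obtain f' g' where "generated_algebra G f'" "generated_algebra G g'"
        "\<forall>x\<in>W. frechet_derivative f (at x) v = f' x" "\<forall>x\<in>W. frechet_derivative g (at x) v = g' x"
        by blast
      then show ?case using add.hyps dif
        by (intro exI[of _ "\<lambda>x. f' x + g' x"])
          (simp add: generated_algebra.add frechet_derivative_add)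
    next
      case (mult f g)
      then obtain f' g' where "generated_algebra G f'" "generated_algebra G g'"
        "\<forall>x\<in>W. frechet_derivative f (at x) v = f' x" "\<forall>x\<in>W. frechet_derivative g (at x) v = g' x"
        by blast
      then show ?case using mult.hyps dif
        by (intro exI[of _ "\<lambda>x. f x * g' x + f' x * g x"])
          (simp add: generated_algebra.add generated_algebra.mult frechet_derivative_mult)
    qed
  qed
qed

lemma smooth_on_smooth_algebra:
  assumes "open W" "generated_algebra (smooth_on W) f"
  shows "smooth_on W f"
proof (rule smooth_on_generated_algebra[OF assms smooth_on_differentiable])
  fix g v assume "smooth_on W g"
  then show "\<exists>g'. generated_algebra (smooth_on W) g' \<and> (\<forall>x\<in>W. frechet_derivative g (at x) v = g' x)"
    by (intro exI[of _ "iter_deriv [v] g"]) (auto intro!: gen smooth_on_iter_deriv simp del: iter_deriv.simps, simp)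
qed

lemma smooth_on_add:
  "open W \<Longrightarrow> smooth_on W f \<Longrightarrow> smooth_on W g \<Longrightarrow> smooth_on W (\<lambda>x. f x + g x)"
  by (rule smooth_on_smooth_algebra) (auto intro: generated_algebra.intros)

lemma smooth_on_mult:
  "open W \<Longrightarrow> smooth_on W f \<Longrightarrow> smooth_on W g \<Longrightarrow> smooth_on W (\<lambda>x. f x * g x)"
  by (rule smooth_on_smooth_algebra) (auto intro: generated_algebra.intros)

lemma smooth_on_const: "open W \<Longrightarrow> smooth_on W (\<lambda>x. c)"
  by (rule smooth_on_coinduct[where P = "\<lambda>f. \<exists>c. f = (\<lambda>x. c)"])
    (auto simp: frechet_derivativeI[OF has_derivative_const])

lemma smooth_on_bounded_linear:
  assumes "open W" "bounded_linear f" shows "smooth_on W f"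
proof (rule smooth_on_coinduct[where P = "\<lambda>f. bounded_linear f \<or> (\<exists>c. f = (\<lambda>x. c))", OF assms(1)])
  fix g :: "'a \<Rightarrow> complex" and v
  assume *: "bounded_linear g \<or> (\<exists>c. g = (\<lambda>x. c))"
  show "\<exists>g'. (bounded_linear g' \<or> (\<exists>c. g' = (\<lambda>x. c))) \<and> (\<forall>x\<in>W. frechet_derivative g (at x) v = g' x)"
  proof (cases "bounded_linear g")
    case True
    then show ?thesis
      by (intro exI[of _ "\<lambda>x. g v"]) (auto simp: frechet_derivativeI[OF bounded_linear_imp_has_derivative])
  next
    case False
    then show ?thesis using *
      by (intro exI[of _ "\<lambda>x. 0"]) (auto simp: frechet_derivativeI[OF has_derivative_const])
  qed
qed (use assms in \<open>auto intro: bounded_linear_imp_differentiable\<close>)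

lemma smooth_on_sum:
  "open W \<Longrightarrow> (\<And>i. i \<in> I \<Longrightarrow> smooth_on W (f i)) \<Longrightarrow> smooth_on W (\<lambda>x. \<Sum>i\<in>I. f i x)"
  by (induction I rule: infinite_finite_induct) (auto intro: smooth_on_add smooth_on_const)

lemma smooth_on_prod:
  "open W \<Longrightarrow> (\<And>i. i \<in> I \<Longrightarrow> smooth_on W (f i)) \<Longrightarrow> smooth_on W (\<lambda>x. \<Prod>i\<in>I. f i x)"
  by (induction I rule: infinite_finite_induct) (auto intro: smooth_on_mult smooth_on_const)

text \<open>The derivative of \<open>1 / f\<close> is \<open>- f' (1 / f)\<^sup>2\<close>, so one new generator \<open>1 / f\<close> suffices.\<close>

lemma smooth_on_inverse:
  assumes "open W" "smooth_on W f" "\<And>x. x \<in> W \<Longrightarrow> f x \<noteq> 0"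
  shows "smooth_on W (\<lambda>x. inverse (f x))"
proof -
  let ?G = "\<lambda>g. smooth_on W g \<or> g = (\<lambda>x. inverse (f x))"
  show ?thesis
  proof (rule smooth_on_generated_algebra[where G = ?G, OF assms(1)])
    show "generated_algebra ?G (\<lambda>x. inverse (f x))" by (rule gen) simp
  next
    fix g x assume "?G g" "x \<in> W"
    then show "g differentiable (at x)"
      using assms smooth_on_differentiable by (auto intro: differentiable_inverse)
  next
    fix g :: "'a \<Rightarrow> complex" and v assume g: "?G g"
    show "\<exists>g'. generated_algebra ?G g' \<and> (\<forall>x\<in>W. frechet_derivative g (at x) v = g' x)"
    proof (cases "smooth_on W g")
      case True
      have "smooth_on W (\<lambda>x. frechet_derivative g (at x) v)"
        using smooth_on_iter_deriv[OF True, of "[v]"] by simp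
      then show ?thesis by (intro exI[of _ "\<lambda>x. frechet_derivative g (at x) v"]) (auto intro: gen)
    next
      case False
      with g have g: "g = (\<lambda>x. inverse (f x))" by blast
      let ?f' = "\<lambda>x. frechet_derivative f (at x) v"
      have G: "?G (\<lambda>x. (-1) * ?f' x)" "?G (\<lambda>x. inverse (f x))"
        using smooth_on_mult[OF assms(1) smooth_on_const[OF assms(1), of "-1"] smooth_on_iter_deriv[OF assms(2), of "[v]"]] by simp_all
      then have "generated_algebra ?G (\<lambda>x. ((-1) * ?f' x) * (inverse (f x) * inverse (f x)))"
        by (intro mult[of _ "\<lambda>x. (-1) * ?f' x"] mult[of _ "\<lambda>x. inverse (f x)"] gen G)
      moreover have "frechet_derivative g (at x) v = ((-1) * ?f' x) * (inverse (f x) * inverse (f x))"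
        if "x \<in> W" for x
      proof -
        have "(f has_derivative frechet_derivative f (at x)) (at x)"
          using assms(2) that smooth_on_differentiable frechet_derivative_works by blast
        from frechet_derivativeI[OF Deriv.has_derivative_inverse[OF assms(3)[OF that] this]]
        show ?thesis unfolding g by simp
      qed
      ultimately show ?thesis by blast
    qed
  qed
qed

lemma smooth_on_cnj:
  assumes "open W" "smooth_on W f"
  shows "smooth_on W (\<lambda>x. cnj (f x))"
proof (rule smooth_on_coinduct[where P = "\<lambda>g. \<exists>f. smooth_on W f \<and> g = (\<lambda>x. cnj (f x))", OF assms(1)])
  fix g :: "'a \<Rightarrow> complex"
  assume "\<exists>f. smooth_on W f \<and> g = (\<lambda>x. cnj (f x))"
  then obtain f where f: "smooth_on W f" "g = (\<lambda>x. cnj (f x))" by blast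
  have d: "(g has_derivative (\<lambda>v. cnj (frechet_derivative f (at x) v))) (at x)" if "x \<in> W" for x
    unfolding f(2)
    by (rule bounded_linear.has_derivative[OF bounded_linear_cnj])
      (use f that smooth_on_differentiable frechet_derivative_works in blast)
  show "x \<in> W \<Longrightarrow> g differentiable (at x)" for x
    using d differentiable_def by blast
  show "\<exists>g'. (\<exists>f. smooth_on W f \<and> g' = (\<lambda>x. cnj (f x))) \<and> (\<forall>x\<in>W. frechet_derivative g (at x) v = g' x)" for v
    using smooth_on_iter_deriv[OF f(1), of "[v]"]
    by (intro exI[of _ "\<lambda>x. cnj (frechet_derivative f (at x) v)"])
      (auto simp: frechet_derivativeI[OF d])
qed (use assms in blast)

section \<open>Bump functions\<close>

text \<open>
  The exponent \<open>k\<close> makes the family closed under differentiation: the derivative of the \<open>k\<close>-th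
  member is a linear combination of the members \<open>k + 1\<close> and \<open>k + 2\<close>.
\<close>

definition flat_exp :: "nat \<Rightarrow> real \<Rightarrow> real" where
  "flat_exp k t = (if t > 0 then exp (- (1 / t)) / t ^ k else 0)"

lemma flat_exp_tendsto_0: "((\<lambda>t. flat_exp k t) \<longlongrightarrow> 0) (at 0)"
proof -
  have "((\<lambda>y::real. y ^ k / exp y) \<longlongrightarrow> 0) at_top" by (rule tendsto_power_div_exp_0)
  then have "((\<lambda>t::real. (inverse t) ^ k / exp (inverse t)) \<longlongrightarrow> 0) (at_right 0)"
    using filterlim_inverse_at_top_right filterlim_compose by blast
  then have r: "(flat_exp k \<longlongrightarrow> 0) (at_right 0)"
    by (rule Lim_transform_eventually)
      (auto simp: flat_exp_def eventually_at_filter exp_minus field_simps)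
  have l: "(flat_exp k \<longlongrightarrow> 0) (at_left 0)"
    by (rule Lim_transform_eventually[OF tendsto_const])
      (auto simp: flat_exp_def eventually_at_filter)
  show ?thesis using r l by (simp add: filterlim_split_at)
qed

lemma flat_exp_has_derivative:
  "(flat_exp k has_real_derivative (flat_exp (k + 2) t - k * flat_exp (k + 1) t)) (at t)"
proof (cases t "0::real" rule: linorder_cases)
  case less
  have "((\<lambda>t. 0) has_real_derivative 0) (at t)" by simp
  moreover have "open {..<0::real}" by simp
  ultimately have "(flat_exp k has_real_derivative 0) (at t)"
    using less by (rule_tac has_field_derivative_transform_within_open[of _ _ _ "{..<0}"]) (auto simp: flat_exp_def)
  then show ?thesis using less by (simp add: flat_exp_def)
next
  case equal
  have "((\<lambda>h. (flat_exp k (0 + h) - flat_exp k 0) / h) \<longlongrightarrow> 0) (at 0)"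
    by (rule Lim_transform_eventually[OF flat_exp_tendsto_0[of "Suc k"]])
      (auto simp: flat_exp_def eventually_at_filter)
  then show ?thesis using equal by (simp add: DERIV_def flat_exp_def)
next
  case greater
  have e: "((\<lambda>t. exp (- (1 / t))) has_real_derivative exp (- (1 / t)) / t^2) (at t)"
    using greater by (auto intro!: derivative_eq_intros simp: power2_eq_square)
  have p: "((\<lambda>t. t ^ k) has_real_derivative real k * t ^ (k - 1)) (at t)"
    using DERIV_pow[of k t] by simp
  have "((\<lambda>t. exp (- (1 / t)) / t ^ k) has_real_derivative
      (exp (- (1 / t)) / t ^ (k+2) - k * (exp (- (1 / t)) / t ^ (k+1)))) (at t)"
    by (rule DERIV_cong[OF DERIV_divide[OF e p]])
      (use greater in \<open>cases k; simp add: field_simps power2_eq_square\<close>)+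
  moreover have "open {0::real<..}" by simp
  ultimately have "(flat_exp k has_real_derivative (exp (- (1 / t)) / t ^ (k+2) - k * (exp (- (1 / t)) / t ^ (k+1)))) (at t)"
    using greater by (rule_tac has_field_derivative_transform_within_open[of _ _ _ "{0<..}"]) (auto simp: flat_exp_def)
  then show ?thesis using greater by (simp add: flat_exp_def)
qed

text \<open>
  By the chain rule, the functions below for varying \<open>k\<close> together with the smooth functions
  generate an algebra that is closed under differentiation.
\<close>

lemma smooth_on_flat_exp_sphere:
  fixes a :: "'a::real_inner"
  shows "smooth_on UNIV (\<lambda>x. complex_of_real (flat_exp k (r - (x - a) \<bullet> (x - a))))"
proof -
  let ?e = "\<lambda>k x. complex_of_real (flat_exp k (r - (x - a) \<bullet> (x - a)))"
  let ?G = "\<lambda>g. smooth_on UNIV g \<or> (\<exists>k. g = ?e k)"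
  have d: "(?e k has_derivative (\<lambda>v. ?e (k+2) x * complex_of_real (-2 * ((x - a) \<bullet> v))
      + of_nat k * ?e (k+1) x * complex_of_real (2 * ((x - a) \<bullet> v)))) (at x)" for k x
  proof -
    have 1: "((\<lambda>x. r - (x - a) \<bullet> (x - a)) has_derivative (\<lambda>v. - 2 * ((x - a) \<bullet> v))) (at x)"
      by (auto intro!: derivative_eq_intros simp: inner_commute)
    have 2: "((\<lambda>x. flat_exp k (r - (x - a) \<bullet> (x - a))) has_derivative
        (\<lambda>v. (flat_exp (k + 2) (r - (x - a) \<bullet> (x - a)) - k * flat_exp (k + 1) (r - (x - a) \<bullet> (x - a)))
          * (- 2 * ((x - a) \<bullet> v)))) (at x)"
      using has_derivative_compose[OF 1 flat_exp_has_derivative[unfolded has_field_derivative_def]]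
      by simp
    show ?thesis
      by (rule has_derivative_eq_rhs[OF bounded_linear.has_derivative[OF bounded_linear_of_real 2]])
        (simp add: fun_eq_iff algebra_simps)
  qed
  have lin: "smooth_on UNIV (\<lambda>x. complex_of_real (c * ((x - a) \<bullet> v)))" for c v
  proof -
    have "bounded_linear (\<lambda>x. complex_of_real (c * (x \<bullet> v)))"
      by (intro bounded_linear_compose[OF bounded_linear_of_real]
          bounded_linear_compose[OF bounded_linear_mult_right] bounded_linear_inner_left)
    then have "smooth_on UNIV (\<lambda>x. complex_of_real (c * (x \<bullet> v)) + complex_of_real (- c * (a \<bullet> v)))"
      by (intro smooth_on_add smooth_on_bounded_linear smooth_on_const) auto
    then show ?thesis by (simp add: algebra_simps)
  qed
  show ?thesis
  proof (rule smooth_on_generated_algebra[where G = ?G])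
    show "generated_algebra ?G (?e k)" by (rule gen) blast
  next
    fix g :: "'a \<Rightarrow> complex" and x assume "?G g"
    then show "g differentiable (at x)"
      using d smooth_on_differentiable differentiable_def by blast
  next
    fix g :: "'a \<Rightarrow> complex" and v assume g: "?G g"
    show "\<exists>g'. generated_algebra ?G g' \<and> (\<forall>x\<in>UNIV. frechet_derivative g (at x) v = g' x)"
    proof (cases "smooth_on UNIV g")
      case True
      have "smooth_on UNIV (\<lambda>x. frechet_derivative g (at x) v)"
        using smooth_on_iter_deriv[OF True, of "[v]"] by simp
      then show ?thesis by (intro exI[of _ "\<lambda>x. frechet_derivative g (at x) v"]) (auto intro: gen)
    next
      case False
      with g obtain k where g: "g = ?e k" by blast
      have "generated_algebra ?G (\<lambda>x. ?e (k+2) x * complex_of_real (-2 * ((x - a) \<bullet> v))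
        + of_nat k * ?e (k+1) x * complex_of_real (2 * ((x - a) \<bullet> v)))"
        by (intro add mult; rule gen; use lin smooth_on_const[OF open_UNIV] in blast)
      then show ?thesis unfolding g using frechet_derivativeI[OF d] by fastforce
    qed
  qed simp
qed

text \<open>
  Test functions are total functions that vanish outside a compact subset of \<open>W\<close>, so integrals
  over \<open>W\<close> are integrals over the whole space, where translations act.
\<close>

definition test_fun :: "'a::euclidean_space set \<Rightarrow> ('a \<Rightarrow> complex) \<Rightarrow> bool" where
  "test_fun W \<phi> \<longleftrightarrow> smooth_on W \<phi> \<and> (\<exists>K. compact K \<and> K \<subseteq> W \<and> (\<forall>x. x \<notin> K \<longrightarrow> \<phi> x = 0))"

lemma ex_bump_function:
  fixes a :: "'a::euclidean_space"
  assumes "open W" "a \<in> W"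
  obtains \<beta> where "test_fun W (\<lambda>x. complex_of_real (\<beta> x))" "\<And>x. \<beta> x \<ge> 0" "\<beta> a > 0"
proof -
  obtain e where e: "e > 0" "cball a e \<subseteq> W" using assms open_contains_cball by blast
  define \<beta> where "\<beta> x = flat_exp 0 (e^2 - (x - a) \<bullet> (x - a))" for x
  have "\<beta> x = 0" if "x \<notin> cball a e" for x
  proof -
    have "e < norm (x - a)" using that by (simp add: dist_norm norm_minus_commute)
    then have "e^2 < (x - a) \<bullet> (x - a)" using e(1)
      by (metis dot_square_norm less_eq_real_def power_strict_mono zero_less_numeral)
    then show ?thesis by (simp add: \<beta>_def flat_exp_def)
  qed
  then have "test_fun W (\<lambda>x. complex_of_real (\<beta> x))"
    unfolding test_fun_def using e smooth_on_subset[OF smooth_on_flat_exp_sphere, of W 0 "e^2" a]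
    by (auto simp: \<beta>_def intro!: exI[of _ "cball a e"])
  moreover have "\<beta> x \<ge> 0" for x by (simp add: \<beta>_def flat_exp_def)
  moreover have "\<beta> a > 0" using e(1) by (simp add: \<beta>_def flat_exp_def)
  ultimately show ?thesis using that by blast
qed

section \<open>Test functions and integration by parts\<close>

lemma iter_deriv_zero: "iter_deriv vs (\<lambda>x. 0) = (\<lambda>x. 0)"
  by (induction vs) (auto simp: frechet_derivativeI[OF has_derivative_const])

lemma test_funE:
  assumes "test_fun W \<phi>"
  obtains K where "compact K" "K \<subseteq> W" "\<And>x. x \<notin> K \<Longrightarrow> \<phi> x = 0"
  using assms unfolding test_fun_def by blast

lemma test_fun_smooth: "test_fun W \<phi> \<Longrightarrow> smooth_on W \<phi>"
  by (simp add: test_fun_def)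

lemma iter_deriv_eq_0_outside:
  assumes "compact K" "\<And>x. x \<notin> K \<Longrightarrow> \<phi> x = 0" "x \<notin> K"
  shows "iter_deriv vs \<phi> x = 0"
proof -
  have "open (- K)" using assms(1) by (simp add: compact_imp_closed open_Compl)
  then have "iter_deriv vs \<phi> x = iter_deriv vs (\<lambda>x. 0) x"
    by (rule iter_deriv_cong_open) (use assms in auto)
  then show ?thesis by (simp add: iter_deriv_zero)
qed

lemma test_fun_smooth_UNIV:
  assumes "test_fun W \<phi>" shows "smooth_on UNIV \<phi>"
proof -
  obtain K where K: "compact K" "K \<subseteq> W" "\<And>x. x \<notin> K \<Longrightarrow> \<phi> x = 0" using assms by (rule test_funE) blast
  have o: "open (- K)" using K(1) by (simp add: compact_imp_closed open_Compl)
  have "smooth_on (- K) \<phi>"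
    using smooth_on_cong[OF o, of \<phi> "\<lambda>x. 0"] smooth_on_const[OF o] K(3) by simp
  then show ?thesis using test_fun_smooth[OF assms] K(2) unfolding smooth_on_def by blast
qed

lemma test_fun_mult_right:
  "open W \<Longrightarrow> test_fun W \<phi> \<Longrightarrow> smooth_on W g \<Longrightarrow> test_fun W (\<lambda>x. \<phi> x * g x)"
  unfolding test_fun_def by (auto intro!: smooth_on_mult)

lemma test_fun_mult_left:
  "open W \<Longrightarrow> test_fun W \<phi> \<Longrightarrow> smooth_on W g \<Longrightarrow> test_fun W (\<lambda>x. g x * \<phi> x)"
  using test_fun_mult_right[of W \<phi> g] by (simp add: mult.commute)

lemma test_fun_zero: "open W \<Longrightarrow> test_fun W (\<lambda>x. 0)"
  unfolding test_fun_def using smooth_on_const[of W 0] by (auto intro: exI[of _ "{}"])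

lemma test_fun_add:
  assumes "open W" "test_fun W \<phi>" "test_fun W \<psi>" shows "test_fun W (\<lambda>x. \<phi> x + \<psi> x)"
proof -
  obtain K where K: "compact K" "K \<subseteq> W" "\<And>x. x \<notin> K \<Longrightarrow> \<phi> x = 0" using assms(2) by (rule test_funE) blast
  obtain L where L: "compact L" "L \<subseteq> W" "\<And>x. x \<notin> L \<Longrightarrow> \<psi> x = 0" using assms(3) by (rule test_funE) blast
  have "smooth_on W (\<lambda>x. \<phi> x + \<psi> x)"
    by (intro smooth_on_add assms test_fun_smooth)
  moreover have "\<forall>x. x \<notin> K \<union> L \<longrightarrow> \<phi> x + \<psi> x = 0" using K(3) L(3) by simp
  ultimately show ?thesis unfolding test_fun_def
    using compact_Un[OF K(1) L(1)] K(2) L(2) by blast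
qed

lemma test_fun_sum:
  "open W \<Longrightarrow> (\<And>i. i \<in> I \<Longrightarrow> test_fun W (f i)) \<Longrightarrow> test_fun W (\<lambda>x. \<Sum>i\<in>I. f i x)"
  by (induction I rule: infinite_finite_induct) (auto intro: test_fun_add test_fun_zero)

lemma test_fun_iter_deriv:
  assumes "test_fun W \<phi>" shows "test_fun W (iter_deriv vs \<phi>)"
proof -
  obtain K where K: "compact K" "K \<subseteq> W" "\<And>x. x \<notin> K \<Longrightarrow> \<phi> x = 0" using assms by (rule test_funE) blast
  show ?thesis unfolding test_fun_def
    using smooth_on_iter_deriv[OF test_fun_smooth[OF assms], of vs] K(1,2)
      iter_deriv_eq_0_outside[of K \<phi> _ vs, OF K(1,3)]
    by blast
qed

lemma test_fun_cong:
  assumes "open W" "test_fun W \<phi>" "\<And>x. x \<in> W \<Longrightarrow> \<psi> x = \<phi> x" "\<And>x. x \<notin> W \<Longrightarrow> \<psi> x = 0"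
  shows "test_fun W \<psi>"
proof -
  obtain K where K: "compact K" "K \<subseteq> W" "\<And>x. x \<notin> K \<Longrightarrow> \<phi> x = 0" using assms(2) by (rule test_funE) blast
  have "smooth_on W \<psi>" using smooth_on_cong[OF assms(1), of \<psi> \<phi>] assms test_fun_smooth by blast
  moreover have "\<psi> x = 0" if "x \<notin> K" for x using assms K that by metis
  ultimately show ?thesis unfolding test_fun_def using K by blast
qed

lemma test_fun_continuous: "test_fun W \<phi> \<Longrightarrow> continuous_on UNIV \<phi>"
  by (intro smooth_on_continuous_on test_fun_smooth_UNIV)

lemma test_fun_integrable:
  assumes "test_fun W \<phi>" shows "integrable lborel \<phi>"
proof -
  obtain K where K: "compact K" "K \<subseteq> W" "\<And>x. x \<notin> K \<Longrightarrow> \<phi> x = 0" using assms by (rule test_funE) blast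
  have "integrable lborel (\<lambda>x. indicator K x *\<^sub>R \<phi> x)"
    by (rule borel_integrable_compact[OF K(1)])
      (use test_fun_continuous[OF assms] continuous_on_subset in blast)
  moreover have "(\<lambda>x. indicator K x *\<^sub>R \<phi> x) = \<phi>"
    using K(3) by (auto simp: fun_eq_iff indicator_def)
  ultimately show ?thesis by simp
qed

lemma test_fun_vanishes: "test_fun W \<phi> \<Longrightarrow> x \<notin> W \<Longrightarrow> \<phi> x = 0"
  unfolding test_fun_def by blast

text \<open>
  By translation invariance all difference quotients of \<open>\<phi>\<close> integrate to \<open>0\<close>, and they converge
  boundedly on a common compact set.
\<close>

lemma integral_directional_derivative_eq_0:
  fixes \<phi> :: "'a::euclidean_space \<Rightarrow> complex"
  assumes "test_fun W \<phi>"
  shows "(LINT x|lborel. frechet_derivative \<phi> (at x) v) = 0"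
proof -
  let ?D = "\<lambda>x. frechet_derivative \<phi> (at x) v"
  obtain K where K: "compact K" "K \<subseteq> W" "\<And>x. x \<notin> K \<Longrightarrow> \<phi> x = 0" using assms by (rule test_funE) blast
  have D: "test_fun W ?D" using test_fun_iter_deriv[OF assms, of "[v]"] by simp
  obtain L where L: "compact L" "L \<subseteq> W" "\<And>x. x \<notin> L \<Longrightarrow> ?D x = 0" using D by (rule test_funE) blast
  obtain B where B: "\<And>x. norm (?D x) \<le> B"
  proof -
    have "bounded (?D ` L)"
      by (intro compact_imp_bounded compact_continuous_image L)
        (use test_fun_continuous[OF D] continuous_on_subset in blast)
    then obtain b where "\<And>x. x \<in> L \<Longrightarrow> norm (?D x) \<le> b" unfolding bounded_iff by auto
    then have "norm (?D x) \<le> max b 0" for x using L(3)[of x] by (cases "x \<in> L") fastforce+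
    then show ?thesis using that by blast
  qed
  have B0: "B \<ge> 0" using B[of 0] norm_ge_zero order_trans by blast
  have diff: "(\<phi> has_derivative frechet_derivative \<phi> (at x)) (at x)" for x
    using test_fun_smooth_UNIV[OF assms] smooth_on_differentiable frechet_derivative_works by blast
  have \<gamma>: "((\<lambda>t. \<phi> (x + t *\<^sub>R v)) has_derivative (\<lambda>s. s *\<^sub>R ?D (x + t *\<^sub>R v))) (at t)" for x t
  proof -
    have "((\<lambda>t. x + t *\<^sub>R v) has_derivative (\<lambda>s. s *\<^sub>R v)) (at t)"
      by (auto intro!: derivative_eq_intros)
    from has_derivative_compose[OF this diff]
    show ?thesis
      by (simp add: linear_cmul[OF has_derivative_linear[OF diff]])
  qed
  define h where "h n = inverse (real (Suc n))" for n
  have h: "0 < h n" "h n \<le> 1" for n by (auto simp: h_def field_simps)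
  \<comment> \<open>Difference quotients along a sequence of steps in \<open>(0, 1]\<close>; all vanish off \<open>K - [0, 1] v\<close>.\<close>
  define s where "s n x = (1 / h n) *\<^sub>R (\<phi> (x + h n *\<^sub>R v) - \<phi> x)" for n x
  define K' where "K' = (\<lambda>(x, t). x - t *\<^sub>R v) ` (K \<times> {0..1})"
  have K': "compact K'" unfolding K'_def
    by (intro compact_continuous_image compact_Times K compact_Icc)
      (auto intro!: continuous_intros simp: case_prod_unfold)
  have bound: "norm (s n x) \<le> indicator K' x * B" for n x
  proof (cases "x \<in> K'")
    case True
    have "norm (\<phi> (x + h n *\<^sub>R v) - \<phi> (x + 0 *\<^sub>R v)) \<le> B * norm (h n - 0)"
    proof (rule differentiable_bound[of UNIV "\<lambda>t. \<phi> (x + t *\<^sub>R v)" "\<lambda>t s. s *\<^sub>R ?D (x + t *\<^sub>R v)"])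
      fix t :: real
      show "onorm (\<lambda>s. s *\<^sub>R ?D (x + t *\<^sub>R v)) \<le> B"
      proof (rule onorm_le)
        fix r :: real
        have "\<bar>r\<bar> * norm (?D (x + t *\<^sub>R v)) \<le> \<bar>r\<bar> * B" by (intro mult_left_mono B) simp
        then show "norm (r *\<^sub>R ?D (x + t *\<^sub>R v)) \<le> B * norm r" by (simp add: mult.commute)
      qed
    qed (use \<gamma> in auto)
    moreover have "norm (s n x) = norm (\<phi> (x + h n *\<^sub>R v) - \<phi> x) / h n"
      using h[of n] by (simp add: s_def)
    ultimately show ?thesis using True h[of n] by (simp add: divide_le_eq)
  next
    case False
    have "x \<notin> K" using False unfolding K'_def by (force intro!: image_eqI[of _ _ "(x, 0)"])
    moreover have "x + h n *\<^sub>R v \<notin> K"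
      using False h[of n] unfolding K'_def
      by (auto simp: image_iff) (metis add_diff_cancel_right' atLeastAtMost_iff less_imp_le)
    ultimately show ?thesis using K(3) False by (simp add: s_def)
  qed
  have lim: "(\<lambda>n. s n x) \<longlonglongrightarrow> ?D x" for x
  proof -
    have n: "((\<lambda>t. norm (\<phi> (x + t *\<^sub>R v) - \<phi> x - t *\<^sub>R ?D x) / norm t) \<longlongrightarrow> 0) (at 0)"
      using \<gamma>[of x 0] by (simp add: has_derivative_at)
    have "((\<lambda>t. norm ((\<phi> (x + t *\<^sub>R v) - \<phi> x) /\<^sub>R t - ?D x)) \<longlongrightarrow> 0) (at 0)"
    proof (rule Lim_transform_eventually[OF n])
      have "norm (\<phi> (x + t *\<^sub>R v) - \<phi> x - t *\<^sub>R ?D x) / norm t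
          = norm ((\<phi> (x + t *\<^sub>R v) - \<phi> x) /\<^sub>R t - ?D x)" if "t \<noteq> 0" for t
      proof -
        have "(\<phi> (x + t *\<^sub>R v) - \<phi> x) /\<^sub>R t - ?D x = (\<phi> (x + t *\<^sub>R v) - \<phi> x - t *\<^sub>R ?D x) /\<^sub>R t"
          using that by (simp add: scaleR_right_diff_distrib)
        then show ?thesis by (simp add: divide_inverse mult.commute)
      qed
      then show "\<forall>\<^sub>F t in at 0. norm (\<phi> (x + t *\<^sub>R v) - \<phi> x - t *\<^sub>R ?D x) / norm t
          = norm ((\<phi> (x + t *\<^sub>R v) - \<phi> x) /\<^sub>R t - ?D x)"
        by (auto simp: eventually_at_filter)
    qed
    then have "((\<lambda>t. (\<phi> (x + t *\<^sub>R v) - \<phi> x) /\<^sub>R t) \<longlongrightarrow> ?D x) (at 0)"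
      by (metis Lim_null tendsto_norm_zero_iff)
    moreover have "filterlim h (at 0) sequentially"
      using LIMSEQ_inverse_real_of_nat h unfolding filterlim_at h_def by (auto simp: less_imp_neq)
    ultimately show ?thesis
      using filterlim_compose unfolding s_def divide_inverse by force
  qed
  have c: "continuous_on UNIV \<phi>" using test_fun_continuous[OF assms] .
  have sm: "s n \<in> borel_measurable lborel" for n
  proof -
    have "continuous_on UNIV (s n)" unfolding s_def
      by (intro continuous_intros continuous_on_compose2[OF c]) auto
    then show ?thesis using borel_measurable_continuous_onI by simp
  qed
  have "(\<lambda>n. integral\<^sup>L lborel (s n)) \<longlonglongrightarrow> integral\<^sup>L lborel ?D"
  proof (rule integral_dominated_convergence[where w = "\<lambda>x. indicator K' x * B"])
    show "?D \<in> borel_measurable lborel"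
      using test_fun_integrable[OF D] by simp
    show "integrable lborel (\<lambda>x. indicator K' x * B)"
      using K' by (intro integrable_mult_left) (auto intro!: emeasure_compact_finite borel_compact)
  qed (use sm lim bound in auto)
  moreover have "integral\<^sup>L lborel (s n) = 0" for n
  proof -
    have i: "integrable lborel \<phi>" by (rule test_fun_integrable[OF assms])
    have e: "integral\<^sup>L lborel \<phi> = integral\<^sup>L lborel (\<lambda>x. \<phi> (h n *\<^sub>R v + x))"
      by (subst lborel_distr_plus[of "h n *\<^sub>R v", symmetric], subst integral_distr)
        (use i in auto)
    have "integrable (distr lborel borel ((+) (h n *\<^sub>R v))) \<phi>"
      using i by (simp add: lborel_distr_plus)
    then have "integrable lborel (\<lambda>x. \<phi> (h n *\<^sub>R v + x))" 
      by (rule integrable_distr[rotated]) simp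
    then show ?thesis using i e unfolding s_def by (simp add: add.commute)
  qed
  ultimately show ?thesis by (simp add: LIMSEQ_const_iff)
qed

text \<open>
  Nothing is known about \<open>c\<close> outside \<open>W\<close>, but \<open>\<psi>\<close> vanishes near every point there, so the
  Leibniz rule holds everywhere.
\<close>

lemma frechet_derivative_test_fun_mult:
  assumes "smooth_on W c" "test_fun W \<psi>" "open W"
  shows "frechet_derivative (\<lambda>x. c x * \<psi> x) (at x) v
    = c x * frechet_derivative \<psi> (at x) v + frechet_derivative c (at x) v * \<psi> x"
proof (cases "x \<in> W")
  case True
  then show ?thesis using assms test_fun_smooth smooth_on_differentiable frechet_derivative_mult by blast
next
  case False
  obtain K where K: "compact K" "K \<subseteq> W" "\<And>x. x \<notin> K \<Longrightarrow> \<psi> x = 0" using assms(2) by (rule test_funE) blast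
  have "x \<notin> K" using K False by blast
  then show ?thesis
    using iter_deriv_eq_0_outside[OF K(1), of \<psi> x "[v]"] K(3)
      iter_deriv_eq_0_outside[OF K(1), of "\<lambda>x. c x * \<psi> x" x "[v]"] by simp
qed

lemma integration_by_parts:
  assumes "open W" "smooth_on W c" "test_fun W \<psi>"
  shows "(LINT x|lborel. c x * frechet_derivative \<psi> (at x) v)
    = - (LINT x|lborel. frechet_derivative c (at x) v * \<psi> x)"
proof -
  have c': "smooth_on W (\<lambda>x. frechet_derivative c (at x) v)"
    using smooth_on_iter_deriv[OF assms(2), of "[v]"] by simp
  have \<psi>': "test_fun W (\<lambda>x. frechet_derivative \<psi> (at x) v)"
    using test_fun_iter_deriv[OF assms(3), of "[v]"] by simp
  have "(LINT x|lborel. frechet_derivative (\<lambda>x. c x * \<psi> x) (at x) v) = 0"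
    by (rule integral_directional_derivative_eq_0[OF test_fun_mult_left[OF assms(1,3,2)]])
  then have "(LINT x|lborel. c x * frechet_derivative \<psi> (at x) v + frechet_derivative c (at x) v * \<psi> x) = 0"
    by (simp add: frechet_derivative_test_fun_mult[OF assms(2,3,1)])
  moreover have "integrable lborel (\<lambda>x. c x * frechet_derivative \<psi> (at x) v)"
    "integrable lborel (\<lambda>x. frechet_derivative c (at x) v * \<psi> x)"
    using test_fun_mult_left[OF assms(1) \<psi>' assms(2)] test_fun_mult_left[OF assms(1,3) c']
      test_fun_integrable by blast+
  ultimately show ?thesis by (simp add: add_eq_0_iff)
qed

lemma ex_adjoint_iter_deriv:
  assumes "open W" "smooth_on W c"
  shows "\<exists>w. smooth_on W w \<and> (\<forall>\<phi>. test_fun W \<phi> \<longrightarrow>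
    (LINT x|lborel. c x * iter_deriv vs \<phi> x) = (LINT x|lborel. \<phi> x * w x))"
  using assms(2)
proof (induction vs arbitrary: c)
  case Nil
  then show ?case by (auto simp: mult.commute intro!: exI[of _ c])
next
  case (Cons v vs)
  let ?c' = "\<lambda>x. (-1) * frechet_derivative c (at x) v"
  have "smooth_on W ?c'"
    using smooth_on_mult[OF assms(1) smooth_on_const[OF assms(1), of "-1"] smooth_on_iter_deriv[OF Cons.prems, of "[v]"]] by simp
  from Cons.IH[OF this] obtain w where w: "smooth_on W w"
    "\<And>\<phi>. test_fun W \<phi> \<Longrightarrow> (LINT x|lborel. ?c' x * iter_deriv vs \<phi> x) = (LINT x|lborel. \<phi> x * w x)"
    by blast
  have "(LINT x|lborel. c x * iter_deriv (v # vs) \<phi> x) = (LINT x|lborel. \<phi> x * w x)"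
    if "test_fun W \<phi>" for \<phi>
    using integration_by_parts[OF assms(1) Cons.prems test_fun_iter_deriv[OF that, of vs], of v] w(2)[OF that]
    by simp
  then show ?case using w(1) by blast
qed

lemma is_lebesgue_density:
  assumes "is_lebesgue M"
  obtains c where "c > 0" "M = density lborel (\<lambda>_. ennreal c)"
proof -
  obtain c where c: "c > 0" "M = scale_measure (ennreal c) lborel"
    using assms unfolding is_lebesgue_def by blast
  have "M = density lborel (\<lambda>_. ennreal c)"
    unfolding c(2) by (rule measure_eqI) (auto simp: emeasure_density_const)
  then show ?thesis using c(1) that by blast
qed

text \<open>Test against \<open>\<beta> cnj h\<close> with a bump function \<open>\<beta>\<close>: then \<open>\<beta> \<bar>h\<bar>\<^sup>2\<close> is continuous and nonnegative
  with integral \<open>0\<close>.\<close>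

lemma fundamental_lemma_of_variations:
  fixes h :: "'a::euclidean_space \<Rightarrow> complex"
  assumes "open W" "smooth_on W h" "x \<in> W"
    and "\<And>\<phi>. test_fun W \<phi> \<Longrightarrow> (LINT x|lborel. \<phi> x * h x) = 0"
  shows "h x = 0"
proof -
  obtain \<beta> where \<beta>: "test_fun W (\<lambda>x. complex_of_real (\<beta> x))" "\<And>x. \<beta> x \<ge> 0" "\<beta> x > 0"
    using ex_bump_function[OF assms(1,3)] by blast
  have t: "test_fun W (\<lambda>x. complex_of_real (\<beta> x) * cnj (h x))"
    by (intro test_fun_mult_right assms smooth_on_cnj \<beta>)
  let ?q = "\<lambda>x. \<beta> x * (cmod (h x))^2"
  have q: "complex_of_real (\<beta> x) * cnj (h x) * h x = complex_of_real (?q x)" for x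
    by (simp add: complex_norm_square[symmetric] mult_ac del: of_real_power)
  have tq: "test_fun W (\<lambda>x. complex_of_real (?q x))"
    using test_fun_mult_right[OF assms(1) t assms(2)] by (simp only: q)
  have "integrable lborel (\<lambda>x. complex_of_real (?q x))"
    using test_fun_integrable[OF tq] .
  then have iq: "integrable lborel ?q"
    using integrable_Re[of lborel "\<lambda>x. complex_of_real (?q x)"] by (simp only: Re_complex_of_real)
  have "complex_of_real (LINT x|lborel. ?q x) = 0"
    using assms(4)[OF t] by (simp only: q integral_complex_of_real)
  then have "(LINT x|lborel. ?q x) = 0" by simp
  then have "AE x in lborel. ?q x = 0"
    using integral_nonneg_eq_0_iff_AE[OF iq] \<beta>(2) by simp
  then have ae: "AE x in lebesgue. x \<in> {x. complex_of_real (?q x) = 0}"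
    by (simp add: AE_completion)
  have "closed {x. complex_of_real (?q x) = 0}"
    by (rule closed_Collect_eq[OF test_fun_continuous[OF tq] continuous_on_const])
  from mem_closed_if_AE_lebesgue[OF this ae, of x] show ?thesis using \<beta>(3) by auto
qed

section \<open>Formal functions\<close>

lemma sum_fun_apply: "(\<Sum>i\<in>I. f i) x = (\<Sum>i\<in>I. f i x)"
  by (induction I rule: infinite_finite_induct) auto

text \<open>
  Subdegrees can jump under addition and are \<open>0\<close> for the zero series; arbitrary lower bounds are
  stable.
\<close>

lemma fls_times_nth_range:
  fixes f g :: "'a::semiring_0 fls"
  assumes "\<And>i. i < a \<Longrightarrow> fls_nth f i = 0" "\<And>j. j < b \<Longrightarrow> fls_nth g j = 0"
  shows "fls_nth (f * g) n = (\<Sum>i\<in>{a..n - b}. fls_nth f i * fls_nth g (n - i))"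
proof -
  let ?T = "\<lambda>i. fls_nth f i * fls_nth g (n - i)"
  let ?N = "{i. fls_nth f i \<noteq> 0 \<and> fls_nth g (n - i) \<noteq> 0}"
  have eq: "sum ?T {c..n - d} = sum ?T ?N"
    if "\<And>i. i < c \<Longrightarrow> fls_nth f i = 0" "\<And>j. j < d \<Longrightarrow> fls_nth g j = 0" for c d
  proof (rule sum.mono_neutral_right)
    show "?N \<subseteq> {c..n - d}"
    proof
      fix i assume "i \<in> ?N"
      then have "\<not> i < c" "\<not> n - i < d" using that by auto
      then show "i \<in> {c..n - d}" by simp
    qed
  qed auto
  show ?thesis unfolding fls_times_nth(2)
    by (subst eq) (auto simp: eq[OF assms])
qed

lemma formal_funsI:
  "(\<And>n. smooth_on W (fls_nth f n)) \<Longrightarrow> (\<And>n x. x \<notin> W \<Longrightarrow> fls_nth f n x = 0) \<Longrightarrow> f \<in> formal_funs W"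
  by (simp add: formal_funs_def)

lemma formal_funs_smooth: "f \<in> formal_funs W \<Longrightarrow> smooth_on W (fls_nth f n)"
  by (simp add: formal_funs_def)

lemma formal_funs_outside: "f \<in> formal_funs W \<Longrightarrow> x \<notin> W \<Longrightarrow> fls_nth f n x = 0"
  by (simp add: formal_funs_def)

lemma formal_funs_eqI:
  assumes "f \<in> formal_funs W" "g \<in> formal_funs W" "\<And>n x. x \<in> W \<Longrightarrow> fls_nth f n x = fls_nth g n x"
  shows "f = g"
proof (rule fls_eqI, rule ext)
  fix n x show "fls_nth f n x = fls_nth g n x"
    using assms by (cases "x \<in> W") (auto simp: formal_funs_outside)
qed

lemma formal_funs_0: "open W \<Longrightarrow> 0 \<in> formal_funs W"
  using smooth_on_const[of W 0] by (intro formal_funsI) (simp_all add: zero_fun_def)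

lemma formal_funs_add:
  "open W \<Longrightarrow> f \<in> formal_funs W \<Longrightarrow> g \<in> formal_funs W \<Longrightarrow> f + g \<in> formal_funs W"
  by (auto intro!: formal_funsI smooth_on_add simp: plus_fun_def formal_funs_smooth formal_funs_outside)

lemma formal_funs_sum:
  "open W \<Longrightarrow> (\<And>i. i \<in> I \<Longrightarrow> f i \<in> formal_funs W) \<Longrightarrow> (\<Sum>i\<in>I. f i) \<in> formal_funs W"
  by (induction I rule: infinite_finite_induct) (auto intro: formal_funs_add formal_funs_0)

lemma formal_funs_uminus:
  assumes "open W" "f \<in> formal_funs W" shows "- f \<in> formal_funs W"
proof (rule formal_funsI)
  fix n
  have "smooth_on W (\<lambda>x. (-1) * fls_nth f n x)"
    by (intro smooth_on_mult smooth_on_const assms formal_funs_smooth)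
  then show "smooth_on W (fls_nth (- f) n)" by (simp add: fun_Compl_def)
qed (use assms formal_funs_outside in auto)

lemma formal_funs_sign:
  assumes "open W" "f \<in> formal_funs W" shows "(-1) ^ k * f \<in> formal_funs W"
  using assms by (cases "even k") (auto intro: formal_funs_uminus)

lemma formal_funs_mult:
  assumes "open W" "f \<in> formal_funs W" "g \<in> formal_funs W"
  shows "f * g \<in> formal_funs W"
proof (rule formal_funsI)
  fix n
  have "fls_nth (f * g) n = (\<lambda>x. \<Sum>i\<in>{fls_subdegree f..n - fls_subdegree g}. fls_nth f i x * fls_nth g (n - i) x)"
    by (simp add: fls_times_nth(2) fun_eq_iff sum_fun_apply)
  then show "smooth_on W (fls_nth (f * g) n)"
    using assms by (auto intro!: smooth_on_sum smooth_on_mult simp: formal_funs_smooth)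
  show "fls_nth (f * g) n x = 0" if "x \<notin> W" for x
    using assms that by (simp add: fls_times_nth(2) sum_fun_apply formal_funs_outside)
qed

lemma smooth_on_on_set: "open W \<Longrightarrow> smooth_on W (on_set W f) \<longleftrightarrow> smooth_on W f"
  by (rule smooth_on_cong) (auto simp: on_set_def)

lemma formal_of_in_formal_funs: "open W \<Longrightarrow> smooth_on W f \<Longrightarrow> formal_of W f \<in> formal_funs W"
  using smooth_on_const[of W 0]
  by (auto intro!: formal_funsI simp: formal_of_def smooth_on_on_set zero_fun_def) (simp add: on_set_def)

lemma formal_one_in_formal_funs: "open W \<Longrightarrow> formal_one W \<in> formal_funs W"
  by (intro formal_of_in_formal_funs smooth_on_const)

lemma formal_one_mult:
  assumes "f \<in> formal_funs W" shows "formal_one W * f = f"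
proof (rule fls_eqI, rule ext)
  fix n x show "fls_nth (formal_one W * f) n x = fls_nth f n x"
    using assms by (simp add: formal_of_def on_set_def formal_funs_outside)
qed

text \<open>
  Coefficientwise test functions, with no compact set common to all coefficients; these are exactly
  the compactly supported formal functions.
\<close>

definition test_formal :: "(complex^'m::finite) set \<Rightarrow> 'm formal \<Rightarrow> bool" where
  "test_formal W f \<longleftrightarrow> (\<forall>n. test_fun W (fls_nth f n))"

lemma test_formal_iff: "test_formal W f \<longleftrightarrow> f \<in> formal_funs W \<and> compact_support W f"
  unfolding test_formal_def formal_funs_def compact_support_def test_fun_def by blast

lemma test_formal_0: "open W \<Longrightarrow> test_formal W 0"
  unfolding test_formal_def by (simp add: zero_fun_def test_fun_zero)

lemma test_formal_add: "open W \<Longrightarrow> test_formal W f \<Longrightarrow> test_formal W g \<Longrightarrow> test_formal W (f + g)"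
  unfolding test_formal_def by (auto simp: plus_fun_def intro!: test_fun_add)

lemma test_formal_sum:
  "open W \<Longrightarrow> (\<And>i. i \<in> I \<Longrightarrow> test_formal W (f i)) \<Longrightarrow> test_formal W (\<Sum>i\<in>I. f i)"
  by (induction I rule: infinite_finite_induct) (auto intro: test_formal_add test_formal_0)

lemma test_formal_mult_right:
  assumes "open W" "test_formal W f" "g \<in> formal_funs W" shows "test_formal W (f * g)"
  unfolding test_formal_def
proof
  fix n
  have "fls_nth (f * g) n = (\<lambda>x. \<Sum>i\<in>{fls_subdegree f..n - fls_subdegree g}. fls_nth f i x * fls_nth g (n - i) x)"
    by (simp add: fls_times_nth(2) fun_eq_iff sum_fun_apply)
  then show "test_fun W (fls_nth (f * g) n)"
    using assms by (auto intro!: test_fun_sum test_fun_mult_right simp: formal_funs_smooth test_formal_def)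
qed

lemma test_formal_mult_left:
  assumes "open W" "g \<in> formal_funs W" "test_formal W f" shows "test_formal W (g * f)"
  using test_formal_mult_right[OF assms(1,3,2)] by (simp add: mult.commute)

lemma test_formal_sign:
  assumes "open W" "test_formal W f" shows "test_formal W ((-1) ^ k * f)"
proof -
  have "test_formal W (formal_of W (\<lambda>x. (-1) ^ k) * f)"
    by (intro test_formal_mult_left formal_of_in_formal_funs smooth_on_const assms)
  moreover have "formal_of W (\<lambda>x. (-1) ^ k) * f = (-1) ^ k * f"
  proof -
    have "f \<in> formal_funs W" using assms test_formal_iff by blast
    then show ?thesis
      by (cases "even k"; intro fls_eqI ext) (auto simp: formal_of_def on_set_def formal_funs_outside)
  qed
  ultimately show ?thesis by simp
qed

section \<open>Formal integrals\<close>

lemma formal_integral_nth: "fls_nth (formal_integral M W h) n = (LINT x:W|M. fls_nth h n x)"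
  unfolding formal_integral_def
  by (rule nth_Abs_fls_ex_lower_bound, rule exI[of _ "fls_subdegree h"])
    (simp add: set_lebesgue_integral_def)

lemma formal_integral_test:
  assumes "c > 0" "M = density lborel (\<lambda>_. ennreal c)" "test_formal W f"
  shows "fls_nth (formal_integral M W f) n = complex_of_real c * (LINT x|lborel. fls_nth f n x)"
proof -
  have t: "test_fun W (fls_nth f n)" using assms(3) unfolding test_formal_def by blast
  have "(\<lambda>x. indicator W x *\<^sub>R fls_nth f n x) = fls_nth f n"
    using test_fun_vanishes[OF t] by (auto simp: fun_eq_iff indicator_def)
  then have "fls_nth (formal_integral M W f) n = integral\<^sup>L M (fls_nth f n)"
    unfolding formal_integral_nth set_lebesgue_integral_def by simp
  also have "\<dots> = (LINT x|lborel. c *\<^sub>R fls_nth f n x)"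
    unfolding assms(2) using test_fun_integrable[OF t] assms(1)
    by (intro integral_density) auto
  finally show ?thesis by (simp add: scaleR_conv_of_real)
qed

lemma is_lebesgue_lborel: "is_lebesgue lborel"
  unfolding is_lebesgue_def by (rule exI[of _ 1]) simp

lemma formal_integral_lborel_test:
  "test_formal W f \<Longrightarrow> fls_nth (formal_integral lborel W f) n = (LINT x|lborel. fls_nth f n x)"
  using formal_integral_test[of 1 lborel W f n] by (simp add: density_1)

lemma formal_integral_sum:
  assumes "is_lebesgue M" "open W" "\<And>i. i \<in> I \<Longrightarrow> test_formal W (f i)"
  shows "formal_integral M W (\<Sum>i\<in>I. f i) = (\<Sum>i\<in>I. formal_integral M W (f i))"
proof -
  obtain c where c: "c > 0" "M = density lborel (\<lambda>_. ennreal c)"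
    using assms(1) by (rule is_lebesgue_density) blast
  show ?thesis
  proof (rule fls_eqI)
    fix n
    have "integrable lborel (fls_nth (f i) n)" if "i \<in> I" for i
      using assms(3)[OF that] test_fun_integrable unfolding test_formal_def by blast
    then show "fls_nth (formal_integral M W (\<Sum>i\<in>I. f i)) n = fls_nth (\<Sum>i\<in>I. formal_integral M W (f i)) n"
      using assms(2,3) formal_integral_test[OF c test_formal_sum[OF assms(2,3)], of I]
      by (simp add: fls_nth_sum formal_integral_test[OF c] sum_fun_apply sum_distrib_left)
  qed
qed

lemma formal_integral_sign:
  "formal_integral M W ((-1) ^ k * f) = (-1) ^ k * formal_integral M W f"
  by (cases "even k"; intro fls_eqI) (auto simp: formal_integral_nth set_lebesgue_integral_def)

section \<open>Bidifferential operators\<close>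

lemma iter_deriv_add:
  assumes "open W" "smooth_on W f" "smooth_on W g" "x \<in> W"
  shows "iter_deriv vs (\<lambda>x. f x + g x) x = iter_deriv vs f x + iter_deriv vs g x"
  using assms(4)
proof (induction vs arbitrary: x)
  case (Cons v vs)
  have "frechet_derivative (iter_deriv vs (\<lambda>x. f x + g x)) (at x)
      = frechet_derivative (\<lambda>x. iter_deriv vs f x + iter_deriv vs g x) (at x)"
    by (rule frechet_derivative_cong_open[OF assms(1) Cons.prems]) (rule Cons.IH)
  then show ?case
    using frechet_derivative_add[of "iter_deriv vs f" x "iter_deriv vs g"] assms Cons.prems
    by (simp add: smooth_on_def)
qed simp

lemma smooth_on_zero: "open W \<Longrightarrow> smooth_on W 0"
  using smooth_on_const[of W 0] by (simp add: zero_fun_def)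

lemma bidiff_opE:
  assumes "bidiff_op U B" "open U"
  obtains S c where "finite S" "\<And>p. p \<in> S \<Longrightarrow> smooth_on U (c p)"
    "\<And>f g x. smooth_on U f \<Longrightarrow> smooth_on U g \<Longrightarrow> x \<in> U \<Longrightarrow>
      B f g x = (\<Sum>p\<in>S. c p x * iter_deriv (fst p) f x * iter_deriv (snd p) g x)"
proof -
  obtain S c where S: "finite S"
    "\<forall>(vs, ws)\<in>S. set vs \<subseteq> Basis \<and> set ws \<subseteq> Basis \<and> smooth_on U (c vs ws)"
    "\<forall>W f g. open W \<and> W \<subseteq> U \<and> smooth_on W f \<and> smooth_on W g \<longrightarrow>
       (\<forall>x\<in>W. B f g x = (\<Sum>(vs, ws)\<in>S. c vs ws x * iter_deriv vs f x * iter_deriv ws g x))"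
    using assms(1) unfolding bidiff_op_def by blast
  show ?thesis
  proof (rule that[of S "\<lambda>p. c (fst p) (snd p)"])
    fix f g x assume *: "smooth_on U f" "smooth_on U g" "x \<in> U"
    have "open U \<and> U \<subseteq> U \<and> smooth_on U f \<and> smooth_on U g" using assms(2) * by blast
    then have "B f g x = (\<Sum>(vs, ws)\<in>S. c vs ws x * iter_deriv vs f x * iter_deriv ws g x)"
      using S(3)[rule_format, of U f g x] * by blast
    then show "B f g x = (\<Sum>p\<in>S. c (fst p) (snd p) x * iter_deriv (fst p) f x * iter_deriv (snd p) g x)"
      by (simp add: case_prod_unfold)
  qed (use S in auto)
qed

context
  fixes U :: "'a::euclidean_space set" and B
  assumes U: "open U" and B: "bidiff_op U B"
begin

lemma bidiff_add_left:
  assumes "smooth_on U f" "smooth_on U f'" "smooth_on U g" "x \<in> U"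
  shows "B (f + f') g x = B f g x + B f' g x"
proof -
  obtain S c where S: "finite S" "\<And>p. p \<in> S \<Longrightarrow> smooth_on U (c p)"
    "\<And>f g x. smooth_on U f \<Longrightarrow> smooth_on U g \<Longrightarrow> x \<in> U \<Longrightarrow>
      B f g x = (\<Sum>p\<in>S. c p x * iter_deriv (fst p) f x * iter_deriv (snd p) g x)"
    using bidiff_opE[OF B U] by blast
  show ?thesis using assms smooth_on_add[OF U assms(1,2)]
    by (simp add: plus_fun_def S(3) iter_deriv_add[OF U assms(1,2,4)] distrib_left distrib_right sum.distrib)
qed

lemma bidiff_add_right:
  assumes "smooth_on U f" "smooth_on U g" "smooth_on U g'" "x \<in> U"
  shows "B f (g + g') x = B f g x + B f g' x"
proof -
  obtain S c where S: "finite S" "\<And>p. p \<in> S \<Longrightarrow> smooth_on U (c p)"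
    "\<And>f g x. smooth_on U f \<Longrightarrow> smooth_on U g \<Longrightarrow> x \<in> U \<Longrightarrow>
      B f g x = (\<Sum>p\<in>S. c p x * iter_deriv (fst p) f x * iter_deriv (snd p) g x)"
    using bidiff_opE[OF B U] by blast
  show ?thesis using assms smooth_on_add[OF U assms(2,3)]
    by (simp add: plus_fun_def S(3) iter_deriv_add[OF U assms(2,3,4)] distrib_left sum.distrib)
qed

lemma bidiff_zero_left: "smooth_on U g \<Longrightarrow> x \<in> U \<Longrightarrow> B 0 g x = 0"
  using bidiff_add_left[OF smooth_on_zero[OF U] smooth_on_zero[OF U], of g x] by simp

lemma bidiff_zero_right: "smooth_on U f \<Longrightarrow> x \<in> U \<Longrightarrow> B f 0 x = 0"
  using bidiff_add_right[OF _ smooth_on_zero[OF U] smooth_on_zero[OF U], of f x] by simp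

lemma bidiff_smooth:
  assumes "smooth_on U f" "smooth_on U g" shows "smooth_on U (B f g)"
proof -
  obtain S c where S: "finite S" "\<And>p. p \<in> S \<Longrightarrow> smooth_on U (c p)"
    "\<And>f g x. smooth_on U f \<Longrightarrow> smooth_on U g \<Longrightarrow> x \<in> U \<Longrightarrow>
      B f g x = (\<Sum>p\<in>S. c p x * iter_deriv (fst p) f x * iter_deriv (snd p) g x)"
    using bidiff_opE[OF B U] by blast
  have "smooth_on U (\<lambda>x. \<Sum>p\<in>S. c p x * iter_deriv (fst p) f x * iter_deriv (snd p) g x)"
    by (intro smooth_on_sum smooth_on_mult U S(2) smooth_on_iter_deriv assms)
  then show ?thesis using smooth_on_cong[OF U, of "B f g"] S(3)[OF assms] by simp
qed

lemma bidiff_test_fun_left: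
  assumes "test_fun U f" "smooth_on U g" shows "test_fun U (on_set U (B f g))"
proof -
  obtain S c where S: "finite S" "\<And>p. p \<in> S \<Longrightarrow> smooth_on U (c p)"
    "\<And>f g x. smooth_on U f \<Longrightarrow> smooth_on U g \<Longrightarrow> x \<in> U \<Longrightarrow>
      B f g x = (\<Sum>p\<in>S. c p x * iter_deriv (fst p) f x * iter_deriv (snd p) g x)"
    using bidiff_opE[OF B U] by blast
  have "test_fun U (\<lambda>x. \<Sum>p\<in>S. c p x * iter_deriv (fst p) f x * iter_deriv (snd p) g x)"
    by (intro test_fun_sum test_fun_mult_right test_fun_mult_left U S(2) smooth_on_iter_deriv
        test_fun_iter_deriv assms)
  then show ?thesis
    by (rule test_fun_cong[OF U]) (use assms in \<open>auto simp: on_set_def S(3) test_fun_smooth\<close>)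
qed

lemma bidiff_test_fun_right:
  assumes "smooth_on U f" "test_fun U g" shows "test_fun U (on_set U (B f g))"
proof -
  obtain S c where S: "finite S" "\<And>p. p \<in> S \<Longrightarrow> smooth_on U (c p)"
    "\<And>f g x. smooth_on U f \<Longrightarrow> smooth_on U g \<Longrightarrow> x \<in> U \<Longrightarrow>
      B f g x = (\<Sum>p\<in>S. c p x * iter_deriv (fst p) f x * iter_deriv (snd p) g x)"
    using bidiff_opE[OF B U] by blast
  have "test_fun U (\<lambda>x. \<Sum>p\<in>S. c p x * iter_deriv (fst p) f x * iter_deriv (snd p) g x)"
    by (intro test_fun_sum test_fun_mult_left smooth_on_mult U S(2) smooth_on_iter_deriv
        test_fun_iter_deriv assms)
  then show ?thesis
    by (rule test_fun_cong[OF U]) (use assms in \<open>auto simp: on_set_def S(3) test_fun_smooth\<close>)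
qed

text \<open>
  For fixed \<open>g\<close> and \<open>h\<close> the operator \<open>\<phi> \<mapsto> B(\<phi>, g) h\<close> is differential with smooth coefficients, and
  \<open>w\<close> is the value of its transpose at the constant \<open>1\<close>.
\<close>

lemma ex_bidiff_adjoint:
  assumes "smooth_on U g" "smooth_on U h"
  shows "\<exists>w. smooth_on U w \<and> (\<forall>\<phi>. test_fun U \<phi> \<longrightarrow>
    (LINT x|lborel. on_set U (B \<phi> g) x * h x) = (LINT x|lborel. \<phi> x * w x))"
proof -
  obtain S c where S: "finite S" "\<And>p. p \<in> S \<Longrightarrow> smooth_on U (c p)"
    "\<And>f g x. smooth_on U f \<Longrightarrow> smooth_on U g \<Longrightarrow> x \<in> U \<Longrightarrow>
      B f g x = (\<Sum>p\<in>S. c p x * iter_deriv (fst p) f x * iter_deriv (snd p) g x)"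
    using bidiff_opE[OF B U] by blast
  define a where "a p x = c p x * iter_deriv (snd p) g x * h x" for p x
  have a: "smooth_on U (a p)" if "p \<in> S" for p
    unfolding a_def by (intro smooth_on_mult smooth_on_iter_deriv U S that assms)
  have "\<forall>p\<in>S. \<exists>w. smooth_on U w \<and> (\<forall>\<phi>. test_fun U \<phi> \<longrightarrow>
    (LINT x|lborel. a p x * iter_deriv (fst p) \<phi> x) = (LINT x|lborel. \<phi> x * w x))"
    using ex_adjoint_iter_deriv[OF U a] by blast
  from bchoice[OF this] obtain w where w: "\<And>p. p \<in> S \<Longrightarrow> smooth_on U (w p)"
    "\<And>p \<phi>. p \<in> S \<Longrightarrow> test_fun U \<phi> \<Longrightarrow>
      (LINT x|lborel. a p x * iter_deriv (fst p) \<phi> x) = (LINT x|lborel. \<phi> x * w p x)"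
    by blast
  have "(LINT x|lborel. on_set U (B \<phi> g) x * h x) = (LINT x|lborel. \<phi> x * (\<Sum>p\<in>S. w p x))"
    if \<phi>: "test_fun U \<phi>" for \<phi>
  proof -
    have i1: "integrable lborel (\<lambda>x. a p x * iter_deriv (fst p) \<phi> x)" if "p \<in> S" for p
      by (intro test_fun_integrable[of U] test_fun_mult_left U a that test_fun_iter_deriv \<phi>)
    have i2: "integrable lborel (\<lambda>x. \<phi> x * w p x)" if "p \<in> S" for p
      by (intro test_fun_integrable[of U] test_fun_mult_right U w that \<phi>)
    have "on_set U (B \<phi> g) x * h x = (\<Sum>p\<in>S. a p x * iter_deriv (fst p) \<phi> x)" for x
    proof (cases "x \<in> U")
      case True
      then show ?thesis using S(3)[OF test_fun_smooth[OF \<phi>] assms(1)]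
        by (simp add: on_set_def a_def sum_distrib_right sum_distrib_left mult_ac)
    next
      case False
      then have "iter_deriv vs \<phi> x = 0" for vs
        using test_fun_vanishes[OF test_fun_iter_deriv[OF \<phi>]] by blast
      then show ?thesis using False by (simp add: on_set_def)
    qed
    then have "(LINT x|lborel. on_set U (B \<phi> g) x * h x)
        = (\<Sum>p\<in>S. LINT x|lborel. a p x * iter_deriv (fst p) \<phi> x)"
      using i1 by simp
    also have "\<dots> = (\<Sum>p\<in>S. LINT x|lborel. \<phi> x * w p x)"
      using w(2)[OF _ \<phi>] by (rule sum.cong[OF refl])
    also have "\<dots> = (LINT x|lborel. \<phi> x * (\<Sum>p\<in>S. w p x))"
      using i2 by (simp add: sum_distrib_left)
    finally show ?thesis .
  qed
  moreover have "smooth_on U (\<lambda>x. \<Sum>p\<in>S. w p x)" by (intro smooth_on_sum U w)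
  ultimately show ?thesis by blast
qed

end

section \<open>The formal product of a family of bidifferential operators\<close>

lemma star_nth:
  "fls_nth (star W C f g) n = on_set W (\<lambda>x.
     \<Sum>i\<in>{fls_subdegree f..n - fls_subdegree g}. \<Sum>j\<in>{fls_subdegree g..n - i}.
       C (nat (n - i - j)) (fls_nth f i) (fls_nth g j) x)"
  unfolding star_def
  by (rule nth_Abs_fls_ex_lower_bound, rule exI[of _ "fls_subdegree f + fls_subdegree g"])
    (auto simp: on_set_def fun_eq_iff)

locale bidifferential_family =
  fixes U :: "(complex^'m::finite) set" and C :: "'m cochains"
  assumes U: "open U" and C: "\<And>r. bidiff_op U (C r)"
begin

abbreviation st (infixl "\<star>" 70) where "f \<star> g \<equiv> star U C f g"
abbreviation "\<F> \<equiv> formal_funs U"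

lemma star_outside: "x \<notin> U \<Longrightarrow> fls_nth (f \<star> g) n x = 0"
  by (simp add: star_nth on_set_def)

text \<open>
  Common bounds for several series, rather than the subdegree of each, are what makes linearity a
  termwise statement.
\<close>

lemma star_nth_range:
  assumes f: "f \<in> \<F>" and g: "g \<in> \<F>" and x: "x \<in> U"
    and a: "\<And>i. i < a \<Longrightarrow> fls_nth f i = 0" and b: "\<And>j. j < b \<Longrightarrow> fls_nth g j = 0"
  shows "fls_nth (f \<star> g) n x = (\<Sum>i\<in>{a..n - b}. \<Sum>j\<in>{b..n - i}.
       C (nat (n - i - j)) (fls_nth f i) (fls_nth g j) x)"
proof -
  define T where "T = (\<lambda>(i, j). C (nat (n - i - j)) (fls_nth f i) (fls_nth g j) x)"
  define N where "N = {(i, j). fls_nth f i \<noteq> 0 \<and> fls_nth g j \<noteq> 0 \<and> i + j \<le> n}"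
  have eq: "(\<Sum>i\<in>{a..n - b}. \<Sum>j\<in>{b..n - i}. C (nat (n - i - j)) (fls_nth f i) (fls_nth g j) x) = sum T N"
    if a: "\<And>i. i < a \<Longrightarrow> fls_nth f i = 0" and b: "\<And>j. j < b \<Longrightarrow> fls_nth g j = 0" for a b
  proof -
    have "(\<Sum>i\<in>{a..n - b}. \<Sum>j\<in>{b..n - i}. C (nat (n - i - j)) (fls_nth f i) (fls_nth g j) x)
      = sum T (SIGMA i:{a..n - b}. {b..n - i})"
      by (simp add: sum.Sigma T_def)
    also have "\<dots> = sum T N"
    proof (rule sum.mono_neutral_right)
      show "N \<subseteq> (SIGMA i:{a..n - b}. {b..n - i})"
      proof
        fix p assume p: "p \<in> N"
        obtain i j where ij: "p = (i, j)" by (cases p)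
        with p have "\<not> i < a" "\<not> j < b" "i + j \<le> n" using a b unfolding N_def by auto
        then show "p \<in> (SIGMA i:{a..n - b}. {b..n - i})" by (auto simp: ij)
      qed
      show "\<forall>p\<in>(SIGMA i:{a..n - b}. {b..n - i}) - N. T p = 0"
      proof
        fix p assume p: "p \<in> (SIGMA i:{a..n - b}. {b..n - i}) - N"
        obtain i j where ij: "p = (i, j)" by (cases p)
        have "fls_nth f i = 0 \<or> fls_nth g j = 0" using p ij unfolding N_def by auto
        then show "T p = 0" unfolding T_def ij
          using bidiff_zero_left[OF U C formal_funs_smooth[OF g] x]
            bidiff_zero_right[OF U C formal_funs_smooth[OF f] x] by auto
      qed
    qed simp
    finally show ?thesis .
  qed
  show ?thesis unfolding star_nth on_set_def
    by (simp add: x eq[OF a b] eq[OF fls_eq0_below_subdegree fls_eq0_below_subdegree])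
qed

lemma star_in_formal_funs:
  assumes "f \<in> \<F>" "g \<in> \<F>" shows "f \<star> g \<in> \<F>"
proof (rule formal_funsI)
  fix n show "smooth_on U (fls_nth (f \<star> g) n)"
    unfolding star_nth smooth_on_on_set[OF U]
    by (intro smooth_on_sum U bidiff_smooth[OF U C] formal_funs_smooth assms)
qed (rule star_outside)

lemma star_add_left:
  assumes f: "f \<in> \<F>" "f' \<in> \<F>" and g: "g \<in> \<F>" shows "(f + f') \<star> g = f \<star> g + f' \<star> g"
proof (rule formal_funs_eqI)
  fix n x assume x: "x \<in> U"
  let ?a = "min (fls_subdegree f) (fls_subdegree f')"
  show "fls_nth ((f + f') \<star> g) n x = fls_nth (f \<star> g + f' \<star> g) n x"
    using f g x formal_funs_add[OF U f]
    by (simp add: star_nth_range[where a = ?a and b = "fls_subdegree g"] sum.distrib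
        bidiff_add_left[OF U C] formal_funs_smooth)
qed (intro star_in_formal_funs formal_funs_add U assms)+

lemma star_add_right:
  assumes f: "f \<in> \<F>" and g: "g \<in> \<F>" "g' \<in> \<F>" shows "f \<star> (g + g') = f \<star> g + f \<star> g'"
proof (rule formal_funs_eqI)
  fix n x assume x: "x \<in> U"
  let ?b = "min (fls_subdegree g) (fls_subdegree g')"
  show "fls_nth (f \<star> (g + g')) n x = fls_nth (f \<star> g + f \<star> g') n x"
    using f g x formal_funs_add[OF U g]
    by (simp add: star_nth_range[where a = "fls_subdegree f" and b = ?b] sum.distrib
        bidiff_add_right[OF U C] formal_funs_smooth)
qed (intro star_in_formal_funs formal_funs_add U assms)+

lemma star_zero_left: "g \<in> \<F> \<Longrightarrow> 0 \<star> g = 0"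
  using star_add_left[of 0 0 g] formal_funs_0[OF U] by simp

lemma star_zero_right: "f \<in> \<F> \<Longrightarrow> f \<star> 0 = 0"
  using star_add_right[of f 0 0] formal_funs_0[OF U] by simp

lemma star_sum_left:
  "(\<And>i. i \<in> I \<Longrightarrow> f i \<in> \<F>) \<Longrightarrow> g \<in> \<F> \<Longrightarrow> (\<Sum>i\<in>I. f i) \<star> g = (\<Sum>i\<in>I. f i \<star> g)"
  by (induction I rule: infinite_finite_induct)
    (auto simp: star_zero_left star_add_left formal_funs_sum[OF U])

lemma star_sum_right:
  "f \<in> \<F> \<Longrightarrow> (\<And>i. i \<in> I \<Longrightarrow> g i \<in> \<F>) \<Longrightarrow> f \<star> (\<Sum>i\<in>I. g i) = (\<Sum>i\<in>I. f \<star> g i)"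
  by (induction I rule: infinite_finite_induct)
    (auto simp: star_zero_right star_add_right formal_funs_sum[OF U])

lemma on_set_sum: "on_set W (\<lambda>x. \<Sum>i\<in>I. f i x) = (\<lambda>x. \<Sum>i\<in>I. on_set W (f i) x)"
  by (auto simp: on_set_def)

lemma test_formal_star_left:
  assumes "test_formal U f" "g \<in> \<F>" shows "test_formal U (f \<star> g)"
  unfolding test_formal_def star_nth on_set_sum
  using assms unfolding test_formal_def
  by (intro allI test_fun_sum U bidiff_test_fun_left[OF U C] formal_funs_smooth) auto

lemma test_formal_star_right:
  assumes "f \<in> \<F>" "test_formal U g" shows "test_formal U (f \<star> g)"
  unfolding test_formal_def star_nth on_set_sum
  using assms unfolding test_formal_def
  by (intro allI test_fun_sum U bidiff_test_fun_right[OF U C] formal_funs_smooth) auto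

text \<open>
  Integration by parts removes all derivatives from the first factor.  Coefficientwise, only
  finitely many of the operators \<open>C\<^sub>r(-, g\<^sub>j)\<close>, multiplied by coefficients of the density,
  contribute to a given power of \<open>\<nu>\<close>, and \<open>w\<close> collects their adjoints.
\<close>

lemma ex_star_adjoint:
  assumes g: "g \<in> \<F>" and D: "D \<in> \<F>" and M: "is_lebesgue M"
  shows "\<exists>w\<in>\<F>. \<forall>f. test_formal U f \<longrightarrow>
    formal_integral lborel U ((f \<star> g) * D) = formal_integral M U (f * w)"
proof -
  obtain c where c: "c > 0" "M = density lborel (\<lambda>_. ennreal c)"
    using M by (rule is_lebesgue_density) blast
  define b k where "b = fls_subdegree g" and "k = fls_subdegree D"
  have "\<exists>w. \<forall>r j l. smooth_on U (w r j l) \<and> (\<forall>\<phi>. test_fun U \<phi> \<longrightarrow>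
      (LINT x|lborel. on_set U (C r \<phi> (fls_nth g j)) x * fls_nth D l x) = (LINT x|lborel. \<phi> x * w r j l x))"
    using ex_bidiff_adjoint[OF U C formal_funs_smooth[OF g] formal_funs_smooth[OF D]]
    by metis
  then obtain w where w: "\<And>r j l. smooth_on U (w r j l)"
    "\<And>r j l \<phi>. test_fun U \<phi> \<Longrightarrow>
      (LINT x|lborel. on_set U (C r \<phi> (fls_nth g j)) x * fls_nth D l x) = (LINT x|lborel. \<phi> x * w r j l x)"
    by blast
  define w0 where "w0 s x = (\<Sum>j\<in>{b..s - k}. \<Sum>q\<in>{j..s - k}. w (nat (q - j)) j (s - q) x)" for s x
  \<comment> \<open>The factor \<open>1 / c\<close> compensates the normalization of the Lebesgue measure \<open>M\<close>.\<close>
  define W where "W = Abs_fls (\<lambda>s. on_set U (\<lambda>x. complex_of_real (1 / c) * w0 s x))"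
  have W_nth: "fls_nth W s = on_set U (\<lambda>x. complex_of_real (1 / c) * w0 s x)" for s
    unfolding W_def
    by (rule nth_Abs_fls_ex_lower_bound, rule exI[of _ "b + k"])
      (auto simp: w0_def on_set_def fun_eq_iff)
  have w0: "smooth_on U (w0 s)" for s
    unfolding w0_def by (intro smooth_on_sum U w)
  have W: "W \<in> \<F>"
  proof (rule formal_funsI)
    fix n show "smooth_on U (fls_nth W n)"
      unfolding W_nth smooth_on_on_set[OF U] by (intro smooth_on_mult smooth_on_const U w0)
  qed (simp add: W_nth on_set_def)
  have W_low: "fls_nth W s = 0" if "s < b + k" for s
    using that by (auto simp: W_nth w0_def on_set_def fun_eq_iff)
  have "formal_integral lborel U ((f \<star> g) * D) = formal_integral M U (f * W)"
    if f: "test_formal U f" for f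
  proof (rule fls_eqI)
    fix n
    define a where "a = fls_subdegree f"
    have fF: "f \<in> \<F>" using f test_formal_iff by blast
    have tf: "test_fun U (fls_nth f i)" for i using f unfolding test_formal_def by blast
    \<comment> \<open>The index \<open>q\<close> is the \<open>\<nu>\<close>-degree that \<open>\<star>\<close> adds to the degree \<open>i\<close> of a term of \<open>f\<close>.\<close>
    define T where "T i j q x = on_set U (C (nat (q - j)) (fls_nth f i) (fls_nth g j)) x * fls_nth D (n - i - q) x"
      for i j q x
    have tT: "test_fun U (T i j q)" for i j q
      unfolding T_def
      by (intro test_fun_mult_right bidiff_test_fun_left U C tf formal_funs_smooth g D)
    have tw: "test_fun U (\<lambda>x. fls_nth f i x * w r j l x)" for i r j l
      by (intro test_fun_mult_right U tf w)
    have tw0: "test_fun U (\<lambda>x. fls_nth f i x * w0 s x)" for i s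
      by (intro test_fun_mult_right U tf w0)
    have star_low: "fls_nth (f \<star> g) p = 0" if "p < a + b" for p
    proof
      fix x show "fls_nth (f \<star> g) p x = 0 x"
        using that by (simp add: star_nth on_set_def a_def b_def)
    qed
    have lhs: "fls_nth ((f \<star> g) * D) n x
        = (\<Sum>i\<in>{a..n - b - k}. \<Sum>j\<in>{b..n - i - k}. \<Sum>q\<in>{j..n - i - k}. T i j q x)" for x
    proof (cases "x \<in> U")
      case True
      have "fls_nth ((f \<star> g) * D) n x = (\<Sum>p\<in>{a + b..n - k}. fls_nth (f \<star> g) p x * fls_nth D (n - p) x)"
        by (subst fls_times_nth_range[where a = "a + b" and b = k])
          (simp_all add: star_low k_def sum_fun_apply)
      also have "\<dots> = (\<Sum>p\<in>{a + b..n - k}. \<Sum>i\<in>{a..p - b}. \<Sum>j\<in>{b..p - i}. T i j (p - i) x)"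
        using True by (simp add: star_nth on_set_def a_def b_def T_def sum_distrib_right)
      also have "\<dots> = (\<Sum>(p, i, j)\<in>(SIGMA p:{a + b..n - k}. SIGMA i:{a..p - b}. {b..p - i}). T i j (p - i) x)"
        by (simp add: sum.Sigma)
      also have "\<dots> = (\<Sum>(i, j, q)\<in>(SIGMA i:{a..n - b - k}. SIGMA j:{b..n - i - k}. {j..n - i - k}). T i j q x)"
        by (rule sum.reindex_bij_witness[where i = "\<lambda>(i, j, q). (q + i, i, j)" and j = "\<lambda>(p, i, j). (i, j, p - i)"])
          auto
      also have "\<dots> = (\<Sum>i\<in>{a..n - b - k}. \<Sum>j\<in>{b..n - i - k}. \<Sum>q\<in>{j..n - i - k}. T i j q x)"
        by (simp add: sum.Sigma)
      finally show ?thesis .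
    next
      case False
      then show ?thesis
        using D formal_funs_outside[OF formal_funs_mult[OF U star_in_formal_funs[OF fF g] D] False]
        by (simp add: T_def on_set_def)
    qed
    have rhs: "complex_of_real c * fls_nth (f * W) n x = (\<Sum>i\<in>{a..n - b - k}. fls_nth f i x * w0 (n - i) x)" for x
    proof -
      have "fls_nth f i x * fls_nth W (n - i) x = complex_of_real (1 / c) * (fls_nth f i x * w0 (n - i) x)" for i
        using formal_funs_outside[OF fF] by (cases "x \<in> U") (simp_all add: W_nth on_set_def)
      then show ?thesis
        using c(1) W_low
        by (subst fls_times_nth_range[where a = a and b = "b + k"])
          (simp_all add: a_def sum_fun_apply sum_distrib_left[symmetric] sum_divide_distrib[symmetric] algebra_simps)
    qed
    have "fls_nth (formal_integral lborel U ((f \<star> g) * D)) n = (LINT x|lborel. fls_nth ((f \<star> g) * D) n x)"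
      by (intro formal_integral_lborel_test test_formal_mult_right test_formal_star_left U f g D)
    also have "\<dots> = (\<Sum>i\<in>{a..n - b - k}. \<Sum>j\<in>{b..n - i - k}. \<Sum>q\<in>{j..n - i - k}. LINT x|lborel. T i j q x)"
      unfolding lhs using test_fun_integrable[OF tT] by simp
    also have "\<dots> = (\<Sum>i\<in>{a..n - b - k}. \<Sum>j\<in>{b..n - i - k}. \<Sum>q\<in>{j..n - i - k}.
        LINT x|lborel. fls_nth f i x * w (nat (q - j)) j (n - i - q) x)"
      unfolding T_def w(2)[OF tf] ..
    also have "\<dots> = (\<Sum>i\<in>{a..n - b - k}. LINT x|lborel. fls_nth f i x * w0 (n - i) x)"
      unfolding w0_def sum_distrib_left using test_fun_integrable[OF tw] by simp
    also have "\<dots> = (LINT x|lborel. complex_of_real c * fls_nth (f * W) n x)"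
      unfolding rhs using test_fun_integrable[OF tw0] by simp
    also have "\<dots> = fls_nth (formal_integral M U (f * W)) n"
      by (simp add: formal_integral_test[OF c test_formal_mult_right[OF U f W]])
    finally show "fls_nth (formal_integral lborel U ((f \<star> g) * D)) n = fls_nth (formal_integral M U (f * W)) n" .
  qed
  then show ?thesis using W by blast
qed

end

section \<open>Grassmann algebra\<close>

lemma inversions_Un_left:
  assumes "finite I" "finite K" "finite L" "I \<inter> K = {}"
  shows "inversions (I \<union> K) L = inversions I L + inversions K L"
proof -
  have "{(a, b) \<in> (I \<union> K) \<times> L. b < a} = {(a, b) \<in> I \<times> L. b < a} \<union> {(a, b) \<in> K \<times> L. b < a}"
    by blast
  moreover have "finite {(a, b) \<in> I \<times> L. b < a}" "finite {(a, b) \<in> K \<times> L. b < a}"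
    using assms by (auto intro: finite_subset[of _ "I \<times> L"] finite_subset[of _ "K \<times> L"])
  ultimately show ?thesis unfolding inversions_def using assms(4)
    by (auto intro!: card_Un_disjoint)
qed

lemma inversions_Un_right:
  assumes "finite I" "finite K" "finite L" "K \<inter> L = {}"
  shows "inversions I (K \<union> L) = inversions I K + inversions I L"
proof -
  have "{(a, b) \<in> I \<times> (K \<union> L). b < a} = {(a, b) \<in> I \<times> K. b < a} \<union> {(a, b) \<in> I \<times> L. b < a}"
    by blast
  moreover have "finite {(a, b) \<in> I \<times> L. b < a}" "finite {(a, b) \<in> I \<times> K. b < a}"
    using assms by (auto intro: finite_subset[of _ "I \<times> L"] finite_subset[of _ "I \<times> K"])
  ultimately show ?thesis unfolding inversions_def using assms(4)
    by (auto intro!: card_Un_disjoint)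
qed

lemma inversions_add_flip:
  assumes "finite I" "finite K" "I \<inter> K = {}"
  shows "inversions I K + inversions K I = card I * card K"
proof -
  let ?X = "{(a, b) \<in> I \<times> K. b < a}" and ?Y = "{(a, b) \<in> I \<times> K. a < b}"
  have "card ?Y = inversions K I"
    unfolding inversions_def
    by (rule bij_betw_same_card[of prod.swap]) (auto simp: bij_betw_def inj_on_def image_iff)
  moreover have "?X \<union> ?Y = I \<times> K" using assms(3) by (auto simp: neq_iff)
  moreover have "card (?X \<union> ?Y) = card ?X + card ?Y"
    by (rule card_Un_disjoint) (use assms in \<open>auto intro: finite_subset[of _ "I \<times> K"]\<close>)
  ultimately show ?thesis by (simp add: inversions_def card_cartesian_product)
qed

lemma inversions_empty [simp]: "inversions {} K = 0" "inversions K {} = 0"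
  by (simp_all add: inversions_def)

text \<open>
  The exponent of the sign in \<open>(\<theta>\<^sup>I \<theta>bar\<^sup>J) (\<theta>\<^sup>K \<theta>bar\<^sup>L)\<close>.  It is biadditive, hence a
  2-cocycle, which is associativity; its symmetrization is the product of the degrees,
  which is supercommutativity.
\<close>

definition sign_exponent :: "nat set \<Rightarrow> nat set \<Rightarrow> nat set \<Rightarrow> nat set \<Rightarrow> nat" where
  "sign_exponent I J K L = card J * card K + inversions I K + inversions J L"

lemma super_mult_apply:
  "super_mult f g A B = (\<Sum>(I, J)\<in>Pow A \<times> Pow B.
     (-1) ^ sign_exponent I J (A - I) (B - J) * f I J * g (A - I) (B - J))"
  unfolding super_mult_def sign_exponent_def by (simp add: sum.cartesian_product)

lemma sign_exponent_cocycle: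
  assumes "finite I1" "finite I2" "finite I3" "finite J1" "finite J2" "finite J3"
    and "I1 \<inter> I2 = {}" "I2 \<inter> I3 = {}" "J1 \<inter> J2 = {}" "J2 \<inter> J3 = {}"
  shows "sign_exponent I1 J1 I2 J2 + sign_exponent (I1 \<union> I2) (J1 \<union> J2) I3 J3
    = sign_exponent I2 J2 I3 J3 + sign_exponent I1 J1 (I2 \<union> I3) (J2 \<union> J3)"
  using assms unfolding sign_exponent_def
  by (simp add: inversions_Un_left inversions_Un_right card_Un_disjoint algebra_simps)

lemma super_mult_infinite: "infinite A \<or> infinite B \<Longrightarrow> super_mult f g A B = 0"
  unfolding super_mult_def by auto

lemma super_mult_assoc: "super_mult (super_mult f g) h = super_mult f (super_mult g h)"
proof (intro ext)
  fix A B :: "nat set"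
  show "super_mult (super_mult f g) h A B = super_mult f (super_mult g h) A B"
  proof (cases "finite A \<and> finite B")
    case False
    then show ?thesis by (auto simp: super_mult_infinite)
  next
    case True
    then have fin: "finite A" "finite B" by auto
    define s where "s I J K L = ((-1) ^ sign_exponent I J K L :: 'a formal)" for I J K L
    define T where "T I J K L =
      s I J K L * s (I \<union> K) (J \<union> L) (A - (I \<union> K)) (B - (J \<union> L)) * f I J * g K L
        * h (A - (I \<union> K)) (B - (J \<union> L))" for I J K L
    have "super_mult (super_mult f g) h A B
      = (\<Sum>(I, J)\<in>Pow A \<times> Pow B. \<Sum>(I', J')\<in>Pow I \<times> Pow J. T I' J' (I - I') (J - J'))"
      unfolding super_mult_apply[of "super_mult f g"] case_prod_unfold
    proof (rule sum.cong[OF refl])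
      fix p assume "p \<in> Pow A \<times> Pow B"
      have *: "(-1) ^ sign_exponent (fst p) (snd p) (A - fst p) (B - snd p)
          * ((-1) ^ sign_exponent (fst q) (snd q) (fst p - fst q) (snd p - snd q) * f (fst q) (snd q)
            * g (fst p - fst q) (snd p - snd q)) * h (A - fst p) (B - snd p)
        = T (fst q) (snd q) (fst p - fst q) (snd p - snd q)"
        if "q \<in> Pow (fst p) \<times> Pow (snd p)" for q
      proof -
        have e: "fst q \<union> (fst p - fst q) = fst p" "snd q \<union> (snd p - snd q) = snd p"
          using that by auto
        show ?thesis unfolding T_def s_def e by (simp only: mult_ac)
      qed
      show "(-1) ^ sign_exponent (fst p) (snd p) (A - fst p) (B - snd p) * super_mult f g (fst p) (snd p)
          * h (A - fst p) (B - snd p)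
        = (\<Sum>q\<in>Pow (fst p) \<times> Pow (snd p). T (fst q) (snd q) (fst p - fst q) (snd p - snd q))"
        unfolding super_mult_apply case_prod_unfold sum_distrib_left sum_distrib_right
        by (rule sum.cong[OF refl], rule *)
    qed
    also have "\<dots> = (\<Sum>((I, J), (I', J'))\<in>(SIGMA p:Pow A \<times> Pow B. Pow (fst p) \<times> Pow (snd p)).
        T I' J' (I - I') (J - J'))"
      unfolding case_prod_unfold by (subst sum.Sigma)
        (use fin finite_subset[OF _ fin(1)] finite_subset[OF _ fin(2)] in \<open>auto simp: case_prod_unfold\<close>)
    also have "\<dots> = (\<Sum>((I, J), (K, L))\<in>(SIGMA p:Pow A \<times> Pow B. Pow (A - fst p) \<times> Pow (B - snd p)).
        T I J K L)"
      by (rule sum.reindex_bij_witness[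
            where i = "\<lambda>((I, J), (K, L)). ((I \<union> K, J \<union> L), (I, J))"
              and j = "\<lambda>((I, J), (I', J')). ((I', J'), (I - I', J - J'))"])
        (auto, (meson subsetD)+)
    also have "\<dots> = (\<Sum>(I, J)\<in>Pow A \<times> Pow B. \<Sum>(K, L)\<in>Pow (A - I) \<times> Pow (B - J). T I J K L)"
      unfolding case_prod_unfold by (subst sum.Sigma) (use fin in \<open>auto simp: case_prod_unfold\<close>)
    also have "\<dots> = super_mult f (super_mult g h) A B"
      unfolding super_mult_apply[of f] case_prod_unfold
    proof (rule sum.cong[OF refl])
      fix p assume p: "p \<in> Pow A \<times> Pow B"
      have *: "T (fst p) (snd p) (fst q) (snd q)
        = (-1) ^ sign_exponent (fst p) (snd p) (A - fst p) (B - snd p) * f (fst p) (snd p)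
          * ((-1) ^ sign_exponent (fst q) (snd q) (A - fst p - fst q) (B - snd p - snd q) * g (fst q) (snd q)
          * h (A - fst p - fst q) (B - snd p - snd q))"
        if q: "q \<in> Pow (A - fst p) \<times> Pow (B - snd p)" for q
      proof -
        have e: "A - (fst p \<union> fst q) = A - fst p - fst q" "B - (snd p \<union> snd q) = B - snd p - snd q"
          "fst q \<union> (A - fst p - fst q) = A - fst p" "snd q \<union> (B - snd p - snd q) = B - snd p"
          using q by auto
        have "sign_exponent (fst p) (snd p) (fst q) (snd q)
            + sign_exponent (fst p \<union> fst q) (snd p \<union> snd q) (A - fst p - fst q) (B - snd p - snd q)
          = sign_exponent (fst q) (snd q) (A - fst p - fst q) (B - snd p - snd q)
            + sign_exponent (fst p) (snd p) (A - fst p) (B - snd p)"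
        proof -
          have sub: "fst p \<subseteq> A" "fst q \<subseteq> A" "snd p \<subseteq> B" "snd q \<subseteq> B"
            using p q by auto
          have dis: "fst p \<inter> fst q = {}" "fst q \<inter> (A - fst p - fst q) = {}"
            "snd p \<inter> snd q = {}" "snd q \<inter> (B - snd p - snd q) = {}"
            using q by auto
          note finite_subset[OF sub(1) fin(1)] finite_subset[OF sub(2) fin(1)] finite_Diff[OF finite_Diff[OF fin(1)]]
            finite_subset[OF sub(3) fin(2)] finite_subset[OF sub(4) fin(2)] finite_Diff[OF finite_Diff[OF fin(2)]]
          from sign_exponent_cocycle[OF this dis] show ?thesis unfolding e(3,4) .
        qed
        then have "s (fst p) (snd p) (fst q) (snd q)
            * s (fst p \<union> fst q) (snd p \<union> snd q) (A - fst p - fst q) (B - snd p - snd q)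
          = s (fst q) (snd q) (A - fst p - fst q) (B - snd p - snd q)
            * s (fst p) (snd p) (A - fst p) (B - snd p)"
          unfolding s_def by (simp only: power_add[symmetric])
        then show ?thesis unfolding T_def e(1,2) s_def[symmetric] by (simp only: mult_ac)
      qed
      show "(\<Sum>q\<in>Pow (A - fst p) \<times> Pow (B - snd p). T (fst p) (snd p) (fst q) (snd q))
        = (-1) ^ sign_exponent (fst p) (snd p) (A - fst p) (B - snd p) * f (fst p) (snd p)
          * super_mult g h (A - fst p) (B - snd p)"
        unfolding super_mult_apply case_prod_unfold sum_distrib_left
        by (rule sum.cong[OF refl], rule *)
    qed
    finally show ?thesis .
  qed
qed

lemma minus_one_power_eqI: "even (a + b) \<Longrightarrow> (-1) ^ a = ((-1) ^ b :: 'a::ring_1)"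
  by (cases "even a") auto

lemma mod_2_eq_iff_even_add: "(a :: nat) mod 2 = b mod 2 \<longleftrightarrow> even (a + b)"
  by presburger

lemma homogeneousD: "homogeneous p f \<Longrightarrow> f I J \<noteq> 0 \<Longrightarrow> even (card I + card J + p)"
  unfolding homogeneous_def mod_2_eq_iff_even_add by blast

lemma homogeneousI: "(\<And>I J. f I J \<noteq> 0 \<Longrightarrow> even (card I + card J + p)) \<Longrightarrow> homogeneous p f"
  unfolding homogeneous_def mod_2_eq_iff_even_add by blast

lemma super_mult_even_commute:
  assumes "homogeneous 0 f" shows "super_mult f g = super_mult g f"
proof (intro ext)
  fix A B :: "nat set"
  show "super_mult f g A B = super_mult g f A B"
  proof (cases "finite A \<and> finite B")
    case False
    then show ?thesis by (auto simp: super_mult_infinite)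
  next
    case True
    have "super_mult f g A B = (\<Sum>(I, J)\<in>Pow A \<times> Pow B.
       (-1) ^ sign_exponent (A - I) (B - J) I J * g (A - I) (B - J) * f I J)"
      unfolding super_mult_apply case_prod_unfold
    proof (rule sum.cong[OF refl])
      fix p assume p: "p \<in> Pow A \<times> Pow B"
      let ?I = "fst p" and ?J = "snd p" and ?K = "A - fst p" and ?L = "B - snd p"
      show "(-1) ^ sign_exponent ?I ?J ?K ?L * f ?I ?J * g ?K ?L
        = (-1) ^ sign_exponent ?K ?L ?I ?J * g ?K ?L * f ?I ?J"
      proof (cases "f ?I ?J = 0")
        case False
        then have ev: "even (card ?I + card ?J)" using homogeneousD[OF assms] by fastforce
        have fin: "finite ?I" "finite ?J" "finite ?K" "finite ?L"
          using p True finite_subset[of _ A] finite_subset[of _ B] by auto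
        have "sign_exponent ?I ?J ?K ?L + sign_exponent ?K ?L ?I ?J
          = (inversions ?I ?K + inversions ?K ?I) + (inversions ?J ?L + inversions ?L ?J)
            + card ?J * card ?K + card ?L * card ?I"
          unfolding sign_exponent_def by simp
        also have "\<dots> = (card ?I + card ?J) * (card ?K + card ?L)"
          using fin by (simp add: inversions_add_flip Diff_Int_distrib algebra_simps)
        finally have "even (sign_exponent ?I ?J ?K ?L + sign_exponent ?K ?L ?I ?J)" using ev by simp
        then show ?thesis by (simp only: minus_one_power_eqI mult_ac)
      qed simp
    qed
    also have "\<dots> = super_mult g f A B" unfolding super_mult_apply
      by (rule sum.reindex_bij_witness[where i = "\<lambda>(I, J). (A - I, B - J)" and j = "\<lambda>(I, J). (A - I, B - J)"])
        (auto simp: double_diff)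
    finally show ?thesis .
  qed
qed

lemma superfuns_formal: "f \<in> superfuns U d \<Longrightarrow> f I J \<in> formal_funs U"
  by (simp add: superfuns_def)

lemma superfuns_outside: "f \<in> superfuns U d \<Longrightarrow> \<not> (I \<subseteq> {1..d} \<and> J \<subseteq> {1..d}) \<Longrightarrow> f I J = 0"
  by (simp add: superfuns_def)

lemma superfunsI:
  "(\<And>I J. f I J \<in> formal_funs U) \<Longrightarrow>
   (\<And>I J. \<not> (I \<subseteq> {1..d} \<and> J \<subseteq> {1..d}) \<Longrightarrow> f I J = 0) \<Longrightarrow> f \<in> superfuns U d"
  by (simp add: superfuns_def)

lemma superfuns_infinite: "f \<in> superfuns U d \<Longrightarrow> infinite I \<or> infinite J \<Longrightarrow> f I J = 0"
  by (rule superfuns_outside) (auto dest: finite_subset[OF _ finite_atLeastAtMost])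

lemma superfuns_mult:
  assumes "open U" "f \<in> superfuns U d" "g \<in> superfuns U d"
  shows "super_mult f g \<in> superfuns U d"
proof (rule superfunsI)
  fix I J show "super_mult f g I J \<in> formal_funs U"
    unfolding super_mult_def mult.assoc
    by (intro formal_funs_sum[OF assms(1)] formal_funs_sign[OF assms(1)] formal_funs_mult[OF assms(1)]
        superfuns_formal[OF assms(2)] superfuns_formal[OF assms(3)])
next
  fix A B assume AB: "\<not> (A \<subseteq> {1..d} \<and> B \<subseteq> {1..d})"
  have "f I J * g (A - I) (B - J) = 0" for I J
  proof (cases "I \<subseteq> {1..d} \<and> J \<subseteq> {1..d}")
    case True
    then have "\<not> (A - I \<subseteq> {1..d} \<and> B - J \<subseteq> {1..d})" using AB by blast
    then show ?thesis using superfuns_outside[OF assms(3)] by auto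
  qed (use superfuns_outside[OF assms(2)] in auto)
  then show "super_mult f g A B = 0" unfolding super_mult_def mult.assoc by simp
qed

lemma superfuns_add:
  assumes "open U" "f \<in> superfuns U d" "g \<in> superfuns U d" shows "f + g \<in> superfuns U d"
  using assms by (auto simp: superfuns_def intro: formal_funs_add)

lemma superfuns_diff:
  assumes "open U" "f \<in> superfuns U d" "g \<in> superfuns U d" shows "f - g \<in> superfuns U d"
proof -
  have "h - k \<in> formal_funs U" if "h \<in> formal_funs U" "k \<in> formal_funs U" for h k
    using formal_funs_add[OF assms(1) that(1) formal_funs_uminus[OF assms(1) that(2)]] by simp
  then show ?thesis using assms by (auto simp: superfuns_def)
qed

lemma superfuns_one: "open U \<Longrightarrow> super_one U \<in> superfuns U d"
  by (auto simp: superfuns_def super_one_def formal_one_in_formal_funs formal_funs_0)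

lemma super_mult_add_right: "super_mult f (g + h) = super_mult f g + super_mult f h"
  by (intro ext) (simp add: super_mult_def distrib_left sum.distrib)

text \<open>Modulo higher degree, a superfunction with body \<open>1\<close> acts as the identity.\<close>

lemma super_mult_lowest_degree:
  assumes "u {} {} = formal_one U" "f \<in> superfuns U d" "finite A" "finite B"
    and "\<And>I J. (I, J) \<in> Pow A \<times> Pow B \<Longrightarrow> (I, J) \<noteq> ({}, {}) \<Longrightarrow> u I J * f (A - I) (B - J) = 0"
  shows "super_mult u f A B = f A B"
proof -
  have "super_mult u f A B = (\<Sum>(I, J)\<in>{({}, {})}.
     (-1) ^ sign_exponent I J (A - I) (B - J) * (u I J * f (A - I) (B - J)))"
    unfolding super_mult_apply mult.assoc
  proof (rule sum.mono_neutral_right)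
    show "\<forall>p\<in>Pow A \<times> Pow B - {({}, {})}.
      (case p of (I, J) \<Rightarrow> (-1) ^ sign_exponent I J (A - I) (B - J) * (u I J * f (A - I) (B - J))) = 0"
      using assms(5) by (metis (no_types, lifting) DiffE case_prod_beta' mult_zero_right prod.collapse singleton_iff)
  qed (use assms(3,4) in auto)
  then show ?thesis
    using formal_one_mult[OF superfuns_formal[OF assms(2)]] assms(1) by (simp add: sign_exponent_def)
qed

lemma super_one_mult:
  assumes "f \<in> superfuns U d" shows "super_mult (super_one U) f = f"
proof (intro ext)
  fix A B :: "nat set"
  show "super_mult (super_one U) f A B = f A B"
  proof (cases "finite A \<and> finite B")
    case False
    then show ?thesis using superfuns_infinite[OF assms] by (auto simp: super_mult_infinite)
  next
    case True
    then show ?thesis by (intro super_mult_lowest_degree[OF _ assms]) (auto simp: super_one_def)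
  qed
qed

lemma homogeneous_super_one: "homogeneous 0 (super_one U)"
  by (rule homogeneousI) (auto simp: super_one_def split: if_splits)

lemma super_mult_one: "f \<in> superfuns U d \<Longrightarrow> super_mult f (super_one U) = f"
  using super_one_mult super_mult_even_commute[OF homogeneous_super_one] by metis

text \<open>
  Adding the defect \<open>1 - u w\<close> to an approximate inverse \<open>w\<close> raises the degree of the defect, and
  there is nothing above degree \<open>2d\<close>.
\<close>

lemma ex_super_inverse:
  assumes U: "open U" and u: "u \<in> superfuns U d" "u {} {} = formal_one U"
  shows "\<exists>w\<in>superfuns U d. super_mult u w = super_one U"
proof -
  have "\<exists>w\<in>superfuns U d. \<forall>A B. finite A \<and> finite B \<and> card A + card B < n \<longrightarrow>
      super_mult u w A B = super_one U A B" for n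
  proof (induction n)
    case 0
    show ?case using superfuns_one[OF U] by auto
  next
    case (Suc n)
    then obtain w where w: "w \<in> superfuns U d"
      "\<And>A B. finite A \<Longrightarrow> finite B \<Longrightarrow> card A + card B < n \<Longrightarrow> super_mult u w A B = super_one U A B"
      by blast
    define e where "e = super_one U - super_mult u w"
    have e: "e \<in> superfuns U d"
      unfolding e_def by (intro superfuns_diff superfuns_one superfuns_mult U u w)
    have "super_mult u (w + e) A B = super_one U A B"
      if AB: "finite A" "finite B" "card A + card B < Suc n" for A B
    proof -
      have "super_mult u e A B = e A B"
      proof (rule super_mult_lowest_degree[of u, OF u(2) e AB(1,2)])
        fix I J assume IJ: "(I, J) \<in> Pow A \<times> Pow B" "(I, J) \<noteq> ({}, {})"
        then have "card (A - I) + card (B - J) < card A + card B"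
        proof -
          have "finite I" "finite J" using IJ AB finite_subset by auto
          then have "card I + card J > 0" using IJ by (auto simp: card_gt_0_iff)
          moreover have "card (A - I) = card A - card I" "card (B - J) = card B - card J"
            using IJ \<open>finite I\<close> \<open>finite J\<close> by (auto intro: card_Diff_subset)
          moreover have "card I \<le> card A" "card J \<le> card B" using IJ AB by (auto intro: card_mono)
          ultimately show ?thesis by linarith
        qed
        then have "e (A - I) (B - J) = 0" unfolding e_def using w(2) AB by simp
        then show "u I J * e (A - I) (B - J) = 0" by simp
      qed
      then show ?thesis by (simp add: super_mult_add_right e_def)
    qed
    moreover have "w + e \<in> superfuns U d" by (intro superfuns_add U w e)
    ultimately show ?case by blast
  qed
  from this[of "Suc (2 * d)"] obtain w where w: "w \<in> superfuns U d"
    "\<And>A B. finite A \<Longrightarrow> finite B \<Longrightarrow> card A + card B < Suc (2 * d) \<Longrightarrow> super_mult u w A B = super_one U A B"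
    by blast
  have "super_mult u w A B = super_one U A B" for A B
  proof (cases "A \<subseteq> {1..d} \<and> B \<subseteq> {1..d}")
    case True
    then have "card A \<le> d" "card B \<le> d" "finite A" "finite B"
      using card_mono[of "{1..d}"] finite_subset[of _ "{1..d}"] by auto
    then show ?thesis by (intro w(2)) auto
  next
    case False
    then show ?thesis
      using superfuns_outside[OF superfuns_mult[OF U u(1) w(1)] False]
        superfuns_outside[OF superfuns_one[OF U] False] by simp
  qed
  then show ?thesis using w(1) by blast
qed

lemma super_inv_props:
  assumes U: "open U" and u: "u \<in> superfuns U d" "u {} {} = formal_one U" "homogeneous 0 u"
  shows "super_inv U d u \<in> superfuns U d" "super_mult u (super_inv U d u) = super_one U"
proof -
  have "\<exists>!w. w \<in> superfuns U d \<and> super_mult u w = super_one U"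
  proof (rule ex_ex1I)
    fix w w' assume w: "w \<in> superfuns U d \<and> super_mult u w = super_one U"
      and w': "w' \<in> superfuns U d \<and> super_mult u w' = super_one U"
    have "w' = super_mult w' (super_mult u w)" using w w' super_mult_one by metis
    also have "\<dots> = super_mult (super_mult u w') w"
      using super_mult_assoc[of w' u w] super_mult_even_commute[OF u(3), of w'] by metis
    also have "\<dots> = w" using w w' super_one_mult by metis
    finally show "w = w'" by simp
  qed (use ex_super_inverse[OF U u(1,2)] in blast)
  from theI'[OF this] show "super_inv U d u \<in> superfuns U d" "super_mult u (super_inv U d u) = super_one U"
    unfolding super_inv_def by auto
qed

lemma super_mult_inv_cancel:
  assumes "open U" "u \<in> superfuns U d" "u {} {} = formal_one U" "homogeneous 0 u" "f \<in> superfuns U d"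
  shows "super_mult u (super_mult (super_inv U d u) f) = f"
    and "super_mult (super_inv U d u) (super_mult u f) = f"
proof -
  note * = super_inv_props[OF assms(1-4)]
  show "super_mult u (super_mult (super_inv U d u) f) = f"
    by (simp add: super_mult_assoc[symmetric] * super_one_mult[OF assms(5)])
  then show "super_mult (super_inv U d u) (super_mult u f) = f"
    by (metis * super_mult_assoc super_mult_even_commute[OF assms(4)] super_one_mult[OF assms(5)])
qed

lemma homogeneous_super_mult:
  assumes "homogeneous p f" "homogeneous q g"
  shows "homogeneous (p + q) (super_mult f g)"
proof (rule homogeneousI)
  fix A B assume nz: "super_mult f g A B \<noteq> 0"
  then have fin: "finite A" "finite B" using super_mult_infinite by blast+
  obtain r where r: "r \<in> Pow A \<times> Pow B"
    "(-1) ^ sign_exponent (fst r) (snd r) (A - fst r) (B - snd r) * f (fst r) (snd r) * g (A - fst r) (B - snd r) \<noteq> 0"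
    using nz unfolding super_mult_apply case_prod_unfold by (rule sum.not_neutral_contains_not_neutral)
  then have "f (fst r) (snd r) \<noteq> 0" "g (A - fst r) (B - snd r) \<noteq> 0" by auto
  then have ev: "even (card (fst r) + card (snd r) + p)" "even (card (A - fst r) + card (B - snd r) + q)"
    using assms homogeneousD by blast+
  have "card A = card (fst r) + card (A - fst r)" "card B = card (snd r) + card (B - snd r)"
    using r(1) fin card_Int_Diff[of A "fst r"] card_Int_Diff[of B "snd r"] by (auto simp: Int_absorb1)
  then show "even (card A + card B + (p + q))" using ev by presburger
qed

lemma super_mult_test_right:
  assumes "open U" "f \<in> superfuns U d" "\<And>I J. test_formal U (g I J)"
  shows "test_formal U (super_mult f g A B)"
  unfolding super_mult_def mult.assoc
  by (intro test_formal_sum[OF assms(1)] test_formal_sign[OF assms(1)] test_formal_mult_left[OF assms(1)]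
      superfuns_formal[OF assms(2)] assms(3))

section \<open>Smoothness of the canonical trace density\<close>

lemma coordinate_derivatives:
  fixes l l' k k' :: "'m::finite"
  shows "d_zbar l (\<lambda>y. cnj (y $ l')) x = (if l = l' then 1 else 0)"
    and "d_z k (\<lambda>y. y $ k') x = (if k = k' then 1 else 0)"
proof -
  have 1: "bounded_linear (\<lambda>y :: complex^'m. cnj (y $ l'))"
    by (intro bounded_linear_compose[OF bounded_linear_cnj] bounded_linear_vec_nth)
  show "d_zbar l (\<lambda>y. cnj (y $ l')) x = (if l = l' then 1 else 0)"
    unfolding d_zbar_def frechet_derivativeI[OF bounded_linear_imp_has_derivative[OF 1]]
    by (simp add: axis_def)
  have 2: "bounded_linear (\<lambda>y :: complex^'m. y $ k')" by (rule bounded_linear_vec_nth)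
  show "d_z k (\<lambda>y. y $ k') x = (if k = k' then 1 else 0)"
    unfolding d_z_def frechet_derivativeI[OF bounded_linear_imp_has_derivative[OF 2]]
    by (simp add: axis_def)
qed

text \<open>The Wirtinger derivatives of coordinates are Kronecker deltas, so one term of the sum survives.\<close>

lemma C1_tensor_entry:
  fixes G :: "complex^'m::finite \<Rightarrow> complex^'m^'m"
  assumes "open U" "C1_tensor U C G" "x \<in> U"
  shows "G x $ l $ k = C 1 (\<lambda>y. cnj (y $ l)) (\<lambda>y. y $ k) x"
proof -
  have s: "smooth_on U (\<lambda>y. cnj (y $ l))" "smooth_on U (\<lambda>y. y $ k)"
    by (intro smooth_on_cnj smooth_on_bounded_linear bounded_linear_vec_nth assms)+
  have "C 1 (\<lambda>y. cnj (y $ l)) (\<lambda>y. y $ k) x = (\<Sum>l'\<in>UNIV. \<Sum>k'\<in>UNIV.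
      G x $ l' $ k' * d_zbar l' (\<lambda>y. cnj (y $ l)) x * d_z k' (\<lambda>y. y $ k) x)"
    using assms s unfolding C1_tensor_def by blast
  also have "\<dots> = (\<Sum>l'\<in>UNIV. \<Sum>k'\<in>UNIV. if k' = k then (if l' = l then G x $ l' $ k' else 0) else 0)"
    by (intro sum.cong) (auto simp: coordinate_derivatives)
  also have "\<dots> = G x $ l $ k" by simp
  finally show ?thesis by simp
qed

text \<open>Polynomials in the entries are smooth, and \<open>det (G\<^sup>-\<^sup>1) = 1 / det G\<close>.\<close>

lemma smooth_on_det_inverse:
  fixes G :: "complex^'m::finite \<Rightarrow> complex^'m^'m"
  assumes U: "open U" and G: "\<And>l k. smooth_on U (\<lambda>x. G x $ l $ k)" and inv: "\<And>x. x \<in> U \<Longrightarrow> invertible (G x)"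
  shows "smooth_on U (\<lambda>x. det (matrix_inv (G x)))"
proof -
  have d: "det (matrix_inv (G x)) = inverse (det (G x))" "det (G x) \<noteq> 0" if "x \<in> U" for x
  proof -
    have "G x ** matrix_inv (G x) = mat 1" 
      using someI_ex[OF inv[OF that, unfolded invertible_def]] unfolding matrix_inv_def by blast
    then have "det (G x) * det (matrix_inv (G x)) = 1" by (metis det_I det_mul)
    then show "det (G x) \<noteq> 0" "det (matrix_inv (G x)) = inverse (det (G x))"
      by (auto simp: inverse_unique)
  qed
  have "smooth_on U (\<lambda>x. det (G x))"
    unfolding det_def
    by (intro smooth_on_sum[OF U] smooth_on_mult[OF U] smooth_on_prod[OF U] smooth_on_const[OF U] G)
  then have "smooth_on U (\<lambda>x. inverse (det (G x)))" using d(2) by (intro smooth_on_inverse U)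
  then show ?thesis using smooth_on_cong[OF U, of "\<lambda>x. det (matrix_inv (G x))"] d(1) by simp
qed

lemma smooth_on_fps_power_nth:
  assumes U: "open U" and "\<And>n. smooth_on U (\<lambda>x. fps_nth (F x) n)"
  shows "smooth_on U (\<lambda>x. fps_nth (F x ^ i) n)"
proof (induction i arbitrary: n)
  case 0
  then show ?case using smooth_on_const[OF U] by (cases n) auto
next
  case (Suc i)
  have "smooth_on U (\<lambda>x. \<Sum>j=0..n. fps_nth (F x) j * fps_nth (F x ^ i) (n - j))"
    by (intro smooth_on_sum smooth_on_mult U assms Suc)
  then show ?case by (simp add: fps_mult_nth)
qed

lemma formal_exp_in_formal_funs:
  assumes U: "open U" and "\<kappa> \<in> formal_funs U"
  shows "formal_exp U \<kappa> \<in> formal_funs U"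
proof -
  have sm: "smooth_on U (\<lambda>x. fps_nth (fps_compose (fps_exp 1) (Abs_fps (\<lambda>j. fls_nth \<kappa> (int j) x))) n)" for n
    unfolding fps_compose_nth
    by (intro smooth_on_sum[OF U] smooth_on_mult[OF U] smooth_on_const[OF U] smooth_on_fps_power_nth[OF U])
      (simp add: formal_funs_smooth[OF assms(2)])
  show ?thesis
  proof (rule formal_funsI)
    fix n show "smooth_on U (fls_nth (formal_exp U \<kappa>) n)"
    proof (cases "n < 0")
      case True
      then show ?thesis using smooth_on_zero[OF U] by (simp add: formal_exp_def)
    next
      case False
      then show ?thesis using sm by (simp add: formal_exp_def smooth_on_on_set[OF U])
    qed
  qed (simp add: formal_exp_def on_set_def)
qed

lemma formal_funs_shift: "f \<in> formal_funs W \<Longrightarrow> fls_shift k f \<in> formal_funs W"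
  by (simp add: formal_funs_def)

text \<open>
  The tensor that nondegeneracy provides and the one in the formula for the density agree on \<open>U\<close>,
  because each is determined by \<open>C\<^sub>1\<close>.
\<close>

lemma trace_density_in_formal_funs:
  fixes U :: "(complex^'m::finite) set"
  assumes U: "open U" and C: "bidiff_op U (C 1)" and "nondegenerate U C" "trace_density_form U C dens"
  shows "dens \<in> formal_funs U"
proof -
  obtain G \<kappa> where G: "C1_tensor U C G" "\<kappa> \<in> formal_funs U"
    "dens = fls_X_intpow (- int CARD('m))
               * formal_of U (\<lambda>x. 2 ^ CARD('m) * det (matrix_inv (G x))) * formal_exp U \<kappa>"
    using assms(4) unfolding trace_density_form_def by blast
  obtain G' where G': "C1_tensor U C G'" "\<forall>x\<in>U. invertible (G' x)"
    using assms(3) unfolding nondegenerate_def by blast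
  have "G x = G' x" if "x \<in> U" for x
    by (simp add: vec_eq_iff C1_tensor_entry[OF U G(1) that] C1_tensor_entry[OF U G'(1) that])
  then have inv: "invertible (G x)" if "x \<in> U" for x using G'(2) that by auto
  have ent: "smooth_on U (\<lambda>x. G x $ l $ k)" for l k
  proof -
    have "smooth_on U (C 1 (\<lambda>y. cnj (y $ l)) (\<lambda>y. y $ k))"
      by (intro bidiff_smooth[OF U C] smooth_on_cnj smooth_on_bounded_linear bounded_linear_vec_nth U)
    then show ?thesis
      using smooth_on_cong[OF U, of "\<lambda>x. G x $ l $ k"] C1_tensor_entry[OF U G(1)] by simp
  qed
  have "formal_of U (\<lambda>x. 2 ^ CARD('m) * det (matrix_inv (G x))) * formal_exp U \<kappa> \<in> formal_funs U"
    by (intro formal_funs_mult[OF U] formal_of_in_formal_funs[OF U] smooth_on_mult[OF U]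
        smooth_on_const[OF U] smooth_on_det_inverse[OF U ent] formal_exp_in_formal_funs[OF U] G(2) inv)
  from formal_funs_shift[OF this, of "int CARD('m)"] show ?thesis
    unfolding G(3) mult.assoc by (subst fls_X_intpow_times_conv_shift(1)) (simp only: minus_minus)
qed

section \<open>Matrices over the star algebra\<close>

locale star_algebra = bidifferential_family U C for U :: "(complex^'m::finite) set" and C +
  fixes d :: nat
  assumes one_star: "f \<in> \<F> \<Longrightarrow> formal_one U \<star> f = f"
    and star_one: "f \<in> \<F> \<Longrightarrow> f \<star> formal_one U = f"
    and star_assoc: "f \<in> \<F> \<Longrightarrow> g \<in> \<F> \<Longrightarrow> h \<in> \<F> \<Longrightarrow> (f \<star> g) \<star> h = f \<star> (g \<star> h)"
begin

abbreviation "\<S> \<equiv> superfuns U d"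
abbreviation mm (infixl "\<odot>" 70) where "M \<odot> N \<equiv> star_matrix_mult U C d M N"

lemma mm_in_superfuns:
  assumes M: "M \<in> \<S>" and N: "N \<in> \<S>" shows "M \<odot> N \<in> \<S>"
proof (rule superfunsI)
  fix I J show "(M \<odot> N) I J \<in> \<F>" unfolding star_matrix_mult_def
    by (intro formal_funs_sum[OF U] star_in_formal_funs superfuns_formal[OF M] superfuns_formal[OF N])
next
  fix I J assume IJ: "\<not> (I \<subseteq> {1..d} \<and> J \<subseteq> {1..d})"
  have "M I Q \<star> N Q J = 0" for Q
  proof (cases "I \<subseteq> {1..d}")
    case True
    then have "N Q J = 0" using IJ superfuns_outside[OF N] by blast
    then show ?thesis using star_zero_right[OF superfuns_formal[OF M]] by simp
  next
    case False
    then have "M I Q = 0" using superfuns_outside[OF M] by blast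
    then show ?thesis using star_zero_left[OF superfuns_formal[OF N]] by simp
  qed
  then show "(M \<odot> N) I J = 0" by (simp add: star_matrix_mult_def)
qed

lemma mm_assoc:
  assumes M: "M \<in> \<S>" and N: "N \<in> \<S>" and P: "P \<in> \<S>"
  shows "(M \<odot> N) \<odot> P = M \<odot> (N \<odot> P)"
proof (intro ext)
  fix K L
  note F = superfuns_formal[OF M] superfuns_formal[OF N] superfuns_formal[OF P]
  have "((M \<odot> N) \<odot> P) K L = (\<Sum>R\<in>Pow {1..d}. \<Sum>Q\<in>Pow {1..d}. (M K Q \<star> N Q R) \<star> P R L)"
    unfolding star_matrix_mult_def
    by (rule sum.cong[OF refl], rule star_sum_left) (intro star_in_formal_funs F)+
  also have "\<dots> = (\<Sum>R\<in>Pow {1..d}. \<Sum>Q\<in>Pow {1..d}. M K Q \<star> (N Q R \<star> P R L))"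
    by (simp add: star_assoc F)
  also have "\<dots> = (\<Sum>Q\<in>Pow {1..d}. \<Sum>R\<in>Pow {1..d}. M K Q \<star> (N Q R \<star> P R L))"
    by (rule sum.swap)
  also have "\<dots> = (M \<odot> (N \<odot> P)) K L"
    unfolding star_matrix_mult_def
    by (rule sum.cong[OF refl], rule star_sum_right[symmetric]) (intro star_in_formal_funs F)+
  finally show "((M \<odot> N) \<odot> P) K L = (M \<odot> (N \<odot> P)) K L" .
qed

lemma one_mm:
  assumes M: "M \<in> \<S>" shows "matrix_one U d \<odot> M = M"
proof (intro ext)
  fix K L
  have "(matrix_one U d \<odot> M) K L = (\<Sum>Q\<in>Pow {1..d}. if Q = K then M K L else 0)"
    unfolding star_matrix_mult_def matrix_one_def
    by (rule sum.cong[OF refl])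
      (auto simp: one_star superfuns_formal[OF M] star_zero_left[OF superfuns_formal[OF M]])
  also have "\<dots> = M K L" using superfuns_outside[OF M, of K L] by simp
  finally show "(matrix_one U d \<odot> M) K L = M K L" .
qed

lemma mm_one:
  assumes M: "M \<in> \<S>" shows "M \<odot> matrix_one U d = M"
proof (intro ext)
  fix K L
  have "(M \<odot> matrix_one U d) K L = (\<Sum>Q\<in>Pow {1..d}. if Q = L then M K L else 0)"
    unfolding star_matrix_mult_def matrix_one_def
    by (rule sum.cong[OF refl])
      (auto simp: star_one superfuns_formal[OF M] star_zero_right[OF superfuns_formal[OF M]])
  also have "\<dots> = M K L" using superfuns_outside[OF M, of K L] by simp
  finally show "(M \<odot> matrix_one U d) K L = M K L" .
qed

lemma mm_nonzeroE:
  assumes M: "M \<in> \<S>" and N: "N \<in> \<S>" and "(M \<odot> N) K L \<noteq> 0"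
  obtains Q where "M K Q \<noteq> 0" "N Q L \<noteq> 0"
proof -
  obtain Q where "M K Q \<star> N Q L \<noteq> 0"
    using assms(3) unfolding star_matrix_mult_def by (rule sum.not_neutral_contains_not_neutral)
  then have "M K Q \<noteq> 0" "N Q L \<noteq> 0"
    using star_zero_left[OF superfuns_formal[OF N]] star_zero_right[OF superfuns_formal[OF M]] by metis+
  then show ?thesis by (rule that)
qed

lemma homogeneous_mm:
  assumes "M \<in> \<S>" "N \<in> \<S>" "homogeneous p M" "homogeneous q N"
  shows "homogeneous (p + q) (M \<odot> N)"
proof (rule homogeneousI)
  fix K L assume "(M \<odot> N) K L \<noteq> 0"
  then obtain Q where "M K Q \<noteq> 0" "N Q L \<noteq> 0" using mm_nonzeroE[OF assms(1,2)] by blast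
  then have "even (card K + card Q + p)" "even (card Q + card L + q)"
    using homogeneousD assms(3,4) by blast+
  then show "even (card K + card L + (p + q))" by presburger
qed

text \<open>
  The even part of a right inverse of an even matrix is again a right inverse, hence agrees with
  the two-sided inverse.
\<close>

lemma homogeneous_star_inverse:
  assumes u: "u \<in> \<S>" "homogeneous 0 u" and v: "is_star_inverse U C d u v"
  shows "homogeneous 0 v"
proof -
  define v' where "v' K L = (if even (card K + card L) then v K L else 0)" for K L
  have vS: "v \<in> \<S>" and uv: "u \<odot> v = matrix_one U d" and vu: "v \<odot> u = matrix_one U d"
    using v unfolding is_star_inverse_def by auto
  have v'S: "v' \<in> \<S>"
    using vS formal_funs_0[OF U] by (auto simp: superfuns_def v'_def)
  have "(u \<odot> v') K L = matrix_one U d K L" for K L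
  proof (cases "even (card K + card L)")
    case True
    have "u K Q \<star> v' Q L = u K Q \<star> v Q L" for Q
    proof (cases "u K Q = 0")
      case True
      then show ?thesis
        using star_zero_left[OF superfuns_formal[OF vS]] star_zero_left[OF superfuns_formal[OF v'S]] by simp
    next
      case False
      then have "even (card K + card Q + 0)" using homogeneousD[OF u(2)] by blast
      then have "even (card Q + card L)" using True by presburger
      then show ?thesis by (simp add: v'_def)
    qed
    then show ?thesis unfolding uv[symmetric] star_matrix_mult_def by simp
  next
    case False
    have "u K Q \<star> v' Q L = 0" for Q
    proof (cases "u K Q = 0")
      case True
      then show ?thesis using star_zero_left[OF superfuns_formal[OF v'S]] by simp
    next
      case nz: False
      then have "even (card K + card Q + 0)" using homogeneousD[OF u(2)] by blast
      then have "odd (card Q + card L)" using False by presburger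
      then show ?thesis using star_zero_right[OF superfuns_formal[OF u(1)]] by (simp add: v'_def)
    qed
    moreover have "K \<noteq> L" using False by auto
    ultimately show ?thesis by (simp add: matrix_one_def star_matrix_mult_def)
  qed
  then have "u \<odot> v' = matrix_one U d" by (intro ext)
  then have "v = v'"
    using mm_assoc[OF vS u(1) v'S] vu one_mm[OF v'S] mm_one[OF vS] by simp
  then show ?thesis by (intro homogeneousI) (auto simp: v'_def fun_eq_iff split: if_splits)
qed

lemma star_inverse_unique:
  assumes "u \<in> \<S>" "is_star_inverse U C d u v" "is_star_inverse U C d u v'"
  shows "v = v'"
  using assms mm_assoc[of v u v'] one_mm[of v'] mm_one[of v] unfolding is_star_inverse_def by metis

lemma test_formal_mm_left:
  assumes "\<And>I J. test_formal U (M I J)" and N: "N \<in> \<S>"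
  shows "test_formal U ((M \<odot> N) K L)"
  unfolding star_matrix_mult_def
  by (intro test_formal_sum[OF U] test_formal_star_left assms(1) superfuns_formal[OF N])

lemma test_formal_mm_right:
  assumes M: "M \<in> \<S>" and "\<And>I J. test_formal U (N I J)"
  shows "test_formal U ((M \<odot> N) K L)"
  unfolding star_matrix_mult_def
  by (intro test_formal_sum[OF U] test_formal_star_right assms(2) superfuns_formal[OF M])

end

section \<open>The canonical supertrace as a Berezin integral\<close>

locale super_star_algebra = star_algebra U C d
  for U :: "(complex^'m::finite) set" and C and d +
  fixes u :: "'m superfun" and dens :: "'m formal" and M :: "(complex^'m) measure"
  assumes admissible: "admissible U C d u"
    and dens: "dens \<in> \<F>"
    and trace: "trace_property U C dens"
    and M: "is_lebesgue M"
begin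

abbreviation "v \<equiv> (THE v. is_star_inverse U C d u v)"
abbreviation "\<sigma> \<equiv> canonical_supertrace U C d u dens"

lemma u: "u \<in> \<S>" "homogeneous 0 u" "u {} {} = formal_one U"
  using admissible unfolding admissible_def by auto

lemma is_star_inverse_v: "is_star_inverse U C d u v"
  using admissible star_inverse_unique[OF u(1)] unfolding admissible_def by (metis theI)

lemma v: "v \<in> \<S>" "u \<odot> v = matrix_one U d" "v \<odot> u = matrix_one U d" "homogeneous 0 v"
  using is_star_inverse_v homogeneous_star_inverse[OF u(1,2) is_star_inverse_v]
  unfolding is_star_inverse_def by auto

lemmas u_cancel = super_mult_inv_cancel[OF U u(1,3,2)]
lemmas u_inv = super_inv_props(1)[OF U u(1,3,2)]

text \<open>Multiplying \<open>f = u\<^sup>-\<^sup>1 (F \<star> u)\<close> by \<open>u\<close> and then by \<open>v\<close> on the right solves it for \<open>F\<close>.\<close>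

lemma matrix_coeffs_eq:
  assumes f: "f \<in> \<S>"
  shows "matrix_coeffs U C d u f = super_mult u f \<odot> v"
proof -
  have uf: "super_mult u f \<in> \<S>" by (rule superfuns_mult[OF U u(1) f])
  show ?thesis unfolding matrix_coeffs_def
  proof (rule the_equality, intro conjI)
    show "super_mult u f \<odot> v \<in> \<S>" by (rule mm_in_superfuns[OF uf v(1)])
    show "f = super_mult (super_inv U d u) (super_mult u f \<odot> v \<odot> u)"
      by (simp add: mm_assoc[OF uf v(1) u(1)] v(3) mm_one[OF uf] u_cancel(2)[OF f])
  next
    fix F assume F: "F \<in> \<S> \<and> f = super_mult (super_inv U d u) (F \<odot> u)"
    then have "super_mult u f = F \<odot> u" using u_cancel(1)[OF mm_in_superfuns[OF _ u(1)]] by metis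
    then show "F = super_mult u f \<odot> v" using F by (simp add: mm_assoc[OF _ u(1) v(1)] v(2) mm_one)
  qed
qed

lemma super_compact_iff: "f \<in> \<S> \<Longrightarrow> super_compact_support U f \<longleftrightarrow> (\<forall>I J. test_formal U (f I J))"
  unfolding super_compact_support_def test_formal_iff by (auto dest: superfuns_formal)

lemma test_u_mult:
  assumes "f \<in> \<S>" "super_compact_support U f" shows "test_formal U (super_mult u f I J)"
  using assms super_compact_iff by (intro super_mult_test_right[OF U u(1)]) blast

text \<open>
  Integrating by parts in each summand of \<open>\<sigma>(f)\<close> leaves the integral of a linear expression in
  the components of \<open>u f\<close>.  Every such expression is the top component of \<open>(u f) W\<close> for a unique
  \<open>W\<close>, because complementary monomials pair nondegenerately; and \<open>(u f) W = f (u W)\<close> as \<open>u\<close> is even.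
\<close>

lemma ex_berezin_density:
  "\<exists>\<rho>\<in>\<S>. \<forall>f\<in>\<S>. super_compact_support U f \<longrightarrow> \<sigma> f = berezin_integral M U d f \<rho>"
proof -
  let ?D = "{1..d}"
  have "\<forall>Q I. \<exists>w. w \<in> \<F> \<and> (\<forall>f. test_formal U f \<longrightarrow>
      formal_integral lborel U ((f \<star> v Q I) * dens) = formal_integral M U (f * w))"
    using ex_star_adjoint[OF superfuns_formal[OF v(1)] dens M] by blast
  then obtain w where w: "\<And>Q I. w Q I \<in> \<F>"
    "\<And>Q I f. test_formal U f \<Longrightarrow>
      formal_integral lborel U ((f \<star> v Q I) * dens) = formal_integral M U (f * w Q I)"
    by metis
  \<comment> \<open>The exponent cancels the sign of \<open>\<theta>\<^sup>I \<theta>bar\<^sup>J \<theta>\<^sup>A \<theta>bar\<^sup>B\<close> for \<open>I = ?D - A\<close>, \<open>J = ?D - B\<close>, and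
    supplies the factor \<open>(-1) ^ card I\<close> of the supertrace.\<close>
  define W where "W A B = (if A \<subseteq> ?D \<and> B \<subseteq> ?D then
    (-1) ^ (card (?D - A) + sign_exponent (?D - A) (?D - B) A B) * w (?D - B) (?D - A) else 0)" for A B
  have W: "W \<in> \<S>"
    by (rule superfunsI) (auto simp: W_def intro: formal_funs_sign[OF U] w formal_funs_0[OF U])
  define \<rho> where "\<rho> = super_mult u W"
  have \<rho>: "\<rho> \<in> \<S>" unfolding \<rho>_def by (rule superfuns_mult[OF U u(1) W])
  have "\<sigma> f = berezin_integral M U d f \<rho>" if f: "f \<in> \<S>" "super_compact_support U f" for f
  proof -
    let ?h = "super_mult u f"
    note th = test_u_mult[OF f]
    have "super_mult f \<rho> = super_mult ?h W"
      unfolding \<rho>_def using super_mult_assoc super_mult_even_commute[OF u(2)] by metis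
    then have top: "super_mult f \<rho> ?D ?D = (\<Sum>I\<in>Pow ?D. \<Sum>J\<in>Pow ?D. (-1) ^ card I * (?h I J * w J I))"
    proof -
      have "(-1) ^ sign_exponent I J (?D - I) (?D - J) * ?h I J * W (?D - I) (?D - J)
        = (-1) ^ card I * (?h I J * w J I)" if "I \<subseteq> ?D" "J \<subseteq> ?D" for I J
      proof -
        have d: "?D - (?D - I) = I" "?D - (?D - J) = J" using that by auto
        have WD: "W (?D - I) (?D - J)
            = (-1) ^ (card I + sign_exponent I J (?D - I) (?D - J)) * w J I"
          unfolding W_def d by (rule if_P) auto
        have "(-1) ^ n * a * ((-1) ^ (k + n) * b) = (-1) ^ k * (a * b)" for n k and a b :: "'m formal"
          by (cases "even n"; cases "even k") auto
        then show ?thesis unfolding WD by blast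
      qed
      then show ?thesis unfolding \<open>super_mult f \<rho> = super_mult ?h W\<close>
        by (simp add: super_mult_apply sum.cartesian_product[symmetric])
    qed
    have tt: "test_formal U ((-1) ^ card I * (?h I J * w J I))" for I J
      by (intro test_formal_sign[OF U] test_formal_mult_right[OF U th w(1)])
    have "\<sigma> f = (\<Sum>I\<in>Pow ?D. (-1) ^ card I * formal_integral lborel U ((?h \<odot> v) I I * dens))"
      unfolding canonical_supertrace_def matrix_coeffs_eq[OF f(1)] ..
    also have "\<dots> = (\<Sum>I\<in>Pow ?D. (-1) ^ card I * (\<Sum>J\<in>Pow ?D. formal_integral M U (?h I J * w J I)))"
    proof (rule sum.cong[OF refl])
      fix I
      have "formal_integral lborel U ((?h \<odot> v) I I * dens)
          = (\<Sum>J\<in>Pow ?D. formal_integral lborel U ((?h I J \<star> v J I) * dens))"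
        unfolding star_matrix_mult_def sum_distrib_right
        by (intro formal_integral_sum[OF is_lebesgue_lborel U] test_formal_mult_right[OF U _ dens]
            test_formal_star_left th superfuns_formal[OF v(1)])
      then show "(-1) ^ card I * formal_integral lborel U ((?h \<odot> v) I I * dens)
          = (-1) ^ card I * (\<Sum>J\<in>Pow ?D. formal_integral M U (?h I J * w J I))"
        by (simp add: w(2)[OF th])
    qed
    also have "\<dots> = (\<Sum>I\<in>Pow ?D. \<Sum>J\<in>Pow ?D. formal_integral M U ((-1) ^ card I * (?h I J * w J I)))"
      by (simp add: formal_integral_sign sum_distrib_left)
    also have "\<dots> = formal_integral M U (super_mult f \<rho> ?D ?D)"
      unfolding top
      by (simp only: formal_integral_sum[OF M U tt] formal_integral_sum[OF M U test_formal_sum[OF U tt]])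
    finally show ?thesis by (simp add: berezin_integral_def)
  qed
  then show ?thesis using \<rho> by blast
qed

text \<open>
  A single component of the density is isolated by pairing with a test function times the
  complementary monomial.
\<close>

lemma berezin_density_unique:
  assumes r: "\<rho> \<in> \<S>" and r': "\<rho>' \<in> \<S>"
    and eq: "\<And>f. f \<in> \<S> \<Longrightarrow> super_compact_support U f \<Longrightarrow>
      berezin_integral M U d f \<rho> = berezin_integral M U d f \<rho>'"
  shows "\<rho> = \<rho>'"
proof (intro ext)
  fix A B
  let ?D = "{1..d}"
  obtain c where c: "c > 0" "M = density lborel (\<lambda>_. ennreal c)"
    using M by (rule is_lebesgue_density) blast
  show "\<rho> A B = \<rho>' A B"
  proof (cases "A \<subseteq> ?D \<and> B \<subseteq> ?D")
    case False
    then show ?thesis using superfuns_outside[OF r False] superfuns_outside[OF r' False] by simp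
  next
    case True
    then have d: "?D - (?D - A) = A" "?D - (?D - B) = B" by auto
    have int_eq: "(LINT x|lborel. \<phi> x * fls_nth (\<rho> A B) n x) = (LINT x|lborel. \<phi> x * fls_nth (\<rho>' A B) n x)"
      if \<phi>: "test_fun U \<phi>" for \<phi> n
    proof -
      have t: "test_formal U (fls_const \<phi>)"
        unfolding test_formal_def using \<phi> test_fun_zero[OF U] by (simp add: zero_fun_def)
      define f where "f = (\<lambda>I J. if I = ?D - A \<and> J = ?D - B then fls_const \<phi> else 0)"
      have tf: "test_formal U (f I J)" for I J
        using t test_formal_0[OF U] by (simp add: f_def)
      have f: "f \<in> \<S>"
      proof (rule superfunsI)
        show "f I J \<in> \<F>" for I J using tf test_formal_iff by blast
      qed (auto simp: f_def)
      let ?k = "sign_exponent (?D - A) (?D - B) A B"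
      have comp: "super_mult f r ?D ?D = (-1) ^ ?k * (fls_const \<phi> * r A B)" for r
      proof -
        have "super_mult f r ?D ?D = (\<Sum>(I, J)\<in>{(?D - A, ?D - B)}.
            (-1) ^ sign_exponent I J (?D - I) (?D - J) * f I J * r (?D - I) (?D - J))"
          unfolding super_mult_apply
        proof (rule sum.mono_neutral_right)
          show "\<forall>p\<in>Pow ?D \<times> Pow ?D - {(?D - A, ?D - B)}. (case p of (I, J) \<Rightarrow>
              (-1) ^ sign_exponent I J (?D - I) (?D - J) * f I J * r (?D - I) (?D - J)) = 0"
          proof
            fix p assume "p \<in> Pow ?D \<times> Pow ?D - {(?D - A, ?D - B)}"
            then have "\<not> (fst p = ?D - A \<and> snd p = ?D - B)" by (metis DiffD2 prod.collapse singletonI)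
            then have "f (fst p) (snd p) = 0" unfolding f_def by (rule if_not_P)
            then show "(case p of (I, J) \<Rightarrow>
              (-1) ^ sign_exponent I J (?D - I) (?D - J) * f I J * r (?D - I) (?D - J)) = 0"
              by (simp add: case_prod_unfold)
          qed
        qed auto
        moreover have "f (?D - A) (?D - B) = fls_const \<phi>" by (simp add: f_def)
        ultimately show ?thesis by (simp only: d mult.assoc sum.insert sum.empty finite.emptyI
              empty_iff not_False_eq_True case_prod_conv add_0_right)
      qed
      have "(-1) ^ ?k * formal_integral M U (fls_const \<phi> * \<rho> A B)
          = (-1) ^ ?k * formal_integral M U (fls_const \<phi> * \<rho>' A B)"
        using eq[OF f] tf super_compact_iff[OF f]
        unfolding berezin_integral_def comp formal_integral_sign by blast
      then have "formal_integral M U (fls_const \<phi> * \<rho> A B) = formal_integral M U (fls_const \<phi> * \<rho>' A B)"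
        by (cases "even ?k") auto
      then show ?thesis
        using c(1) formal_integral_test[OF c test_formal_mult_right[OF U t superfuns_formal[OF r]], of A B n]
          formal_integral_test[OF c test_formal_mult_right[OF U t superfuns_formal[OF r']], of A B n]
        by simp
    qed
    show ?thesis
    proof (rule formal_funs_eqI[OF superfuns_formal[OF r] superfuns_formal[OF r']])
      fix n x assume x: "x \<in> U"
      let ?h = "\<lambda>x. fls_nth (\<rho> A B) n x + (-1) * fls_nth (\<rho>' A B) n x"
      have s: "smooth_on U (fls_nth (\<rho> A B) n)" "smooth_on U (fls_nth (\<rho>' A B) n)"
        using superfuns_formal[OF r] superfuns_formal[OF r'] formal_funs_smooth by blast+
      have "smooth_on U ?h"
        by (intro smooth_on_add[OF U] smooth_on_mult[OF U] smooth_on_const[OF U] s)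
      then have "?h x = 0"
      proof (rule fundamental_lemma_of_variations[OF U _ x])
        fix \<phi> assume \<phi>: "test_fun U \<phi>"
        have "integrable lborel (\<lambda>x. \<phi> x * fls_nth (\<rho> A B) n x)"
          "integrable lborel (\<lambda>x. \<phi> x * fls_nth (\<rho>' A B) n x)"
          using test_fun_integrable test_fun_mult_right[OF U \<phi>] s by blast+
        then show "(LINT x|lborel. \<phi> x * ?h x) = 0"
          using int_eq[OF \<phi>, of n] by (simp add: algebra_simps)
      qed
      then show "fls_nth (\<rho> A B) n x = fls_nth (\<rho>' A B) n x" by simp
    qed
  qed
qed

lemma assoc_product_eq:
  "assoc_product U C d u f g
    = super_mult (super_inv U d u) (super_mult u f \<odot> v \<odot> super_mult u g)"
  by (simp add: assoc_product_def Let_def)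

lemma assoc_product_in_superfuns:
  assumes "f \<in> \<S>" "g \<in> \<S>" shows "assoc_product U C d u f g \<in> \<S>"
  unfolding assoc_product_eq
  by (intro superfuns_mult[OF U] mm_in_superfuns u_inv u(1) v(1) assms)

lemma assoc_product_compact:
  assumes f: "f \<in> \<S>" and g: "g \<in> \<S>" and "super_compact_support U f \<or> super_compact_support U g"
  shows "super_compact_support U (assoc_product U C d u f g)"
proof -
  have uf: "super_mult u f \<in> \<S>" and ug: "super_mult u g \<in> \<S>"
    by (intro superfuns_mult[OF U u(1)] f g)+
  have "test_formal U ((super_mult u f \<odot> v \<odot> super_mult u g) I J)" for I J
    using assms(3)
  proof
    assume "super_compact_support U f"
    then show ?thesis by (intro test_formal_mm_left test_u_mult f ug v(1))
  next
    assume "super_compact_support U g"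
    then show ?thesis by (intro test_formal_mm_right mm_in_superfuns test_u_mult uf g v(1))
  qed
  then have "test_formal U (assoc_product U C d u f g I J)" for I J
    unfolding assoc_product_eq by (intro super_mult_test_right[OF U u_inv])
  then show ?thesis using super_compact_iff[OF assoc_product_in_superfuns[OF f g]] by blast
qed

text \<open>This is the reason for the form of the product: \<open>u (f * g) = (u f) \<star> v \<star> (u g)\<close>.\<close>

lemma matrix_coeffs_assoc_product:
  assumes f: "f \<in> \<S>" and g: "g \<in> \<S>"
  shows "matrix_coeffs U C d u (assoc_product U C d u f g)
    = matrix_coeffs U C d u f \<odot> matrix_coeffs U C d u g"
proof -
  have uf: "super_mult u f \<in> \<S>" and ug: "super_mult u g \<in> \<S>"
    by (intro superfuns_mult[OF U u(1)] f g)+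
  have 1: "super_mult u f \<odot> v \<in> \<S>" by (rule mm_in_superfuns[OF uf v(1)])
  have "super_mult u (assoc_product U C d u f g) = super_mult u f \<odot> v \<odot> super_mult u g"
    unfolding assoc_product_eq by (rule u_cancel(1)) (rule mm_in_superfuns[OF 1 ug])
  then show ?thesis
    unfolding matrix_coeffs_eq[OF assoc_product_in_superfuns[OF f g]] matrix_coeffs_eq[OF f] matrix_coeffs_eq[OF g]
    using mm_assoc[OF 1 ug v(1)] by simp
qed

text \<open>
  In terms of matrix coefficients \<open>*\<close> is matrix multiplication over the star algebra and \<open>\<sigma>\<close> is the
  composition of the matrix supertrace with the trace of \<open>\<star>\<close>.
\<close>

lemma canonical_supertrace_supercommutes:
  assumes f: "f \<in> \<S>" and g: "g \<in> \<S>" and p: "homogeneous p f" and q: "homogeneous q g"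
    and comp: "super_compact_support U f \<or> super_compact_support U g"
  shows "\<sigma> (assoc_product U C d u f g) = (-1) ^ (p * q) * \<sigma> (assoc_product U C d u g f)"
proof -
  let ?D = "{1..d}"
  define F where "F = matrix_coeffs U C d u f"
  define G where "G = matrix_coeffs U C d u g"
  have Fe: "F = super_mult u f \<odot> v" and Ge: "G = super_mult u g \<odot> v"
    unfolding F_def G_def using matrix_coeffs_eq f g by auto
  have uf: "super_mult u f \<in> \<S>" and ug: "super_mult u g \<in> \<S>"
    by (intro superfuns_mult[OF U u(1)] f g)+
  have F: "F \<in> \<S>" and G: "G \<in> \<S>" unfolding Fe Ge by (intro mm_in_superfuns uf ug v(1))+
  have Fp: "homogeneous p F" and Gq: "homogeneous q G"
    using homogeneous_mm[OF uf v(1) homogeneous_super_mult[OF u(2) p] v(4)]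
      homogeneous_mm[OF ug v(1) homogeneous_super_mult[OF u(2) q] v(4)] unfolding Fe Ge by auto
  have test: "(\<forall>I J. test_formal U (F I J)) \<or> (\<forall>I J. test_formal U (G I J))"
    using comp unfolding Fe Ge by (auto intro!: test_formal_mm_left test_u_mult f g v(1))
  have t: "test_formal U (F I K \<star> G K' I')" "test_formal U (G K' I' \<star> F I K)" for I K K' I'
    using test test_formal_star_left test_formal_star_right superfuns_formal[OF F] superfuns_formal[OF G]
    by blast+
  define X where "X I K = formal_integral lborel U ((F I K \<star> G K I) * dens)" for I K
  have X': "formal_integral lborel U ((G K I \<star> F I K) * dens) = X I K" for I K
    unfolding X_def using trace test superfuns_formal[OF F] superfuns_formal[OF G]
    unfolding trace_property_def test_formal_iff by metis
  have sgn: "(-1) ^ card I * X I K = (-1) ^ (p * q) * ((-1) ^ card K * X I K)" for I K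
  proof (cases "F I K = 0 \<or> G K I = 0")
    case True
    then have "F I K \<star> G K I = 0"
      using star_zero_left[OF superfuns_formal[OF G]] star_zero_right[OF superfuns_formal[OF F]] by auto
    then have "X I K = 0" unfolding X_def
      by (intro fls_eqI) (simp add: formal_integral_nth set_lebesgue_integral_def)
    then show ?thesis by simp
  next
    case False
    \<comment> \<open>A nonzero term forces \<open>p\<close> and \<open>q\<close> to have the same parity.\<close>
    then have "even (card I + card K + p)" "even (card K + card I + q)"
      using homogeneousD[OF Fp] homogeneousD[OF Gq] by blast+
    then have "even (card I + (p * q + card K))" by auto
    then show ?thesis using minus_one_power_eqI[of "card I" "p * q + card K"]
      by (metis mult.assoc power_add)
  qed
  have "\<sigma> (assoc_product U C d u f g) = (\<Sum>I\<in>Pow ?D. \<Sum>K\<in>Pow ?D. (-1) ^ card I * X I K)"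
    unfolding canonical_supertrace_def matrix_coeffs_assoc_product[OF f g] F_def[symmetric] G_def[symmetric]
  proof (rule sum.cong[OF refl])
    fix I
    have "formal_integral lborel U ((F \<odot> G) I I * dens) = (\<Sum>K\<in>Pow ?D. X I K)"
      unfolding star_matrix_mult_def sum_distrib_right X_def
      by (intro formal_integral_sum[OF is_lebesgue_lborel U] test_formal_mult_right[OF U _ dens] t)
    then show "(-1) ^ card I * formal_integral lborel U ((F \<odot> G) I I * dens) = (\<Sum>K\<in>Pow ?D. (-1) ^ card I * X I K)"
      by (simp add: sum_distrib_left)
  qed
  also have "\<dots> = (-1) ^ (p * q) * (\<Sum>I\<in>Pow ?D. \<Sum>K\<in>Pow ?D. (-1) ^ card K * X I K)"
    unfolding sgn sum_distrib_left ..
  also have "(\<Sum>I\<in>Pow ?D. \<Sum>K\<in>Pow ?D. (-1) ^ card K * X I K)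
      = (\<Sum>K\<in>Pow ?D. \<Sum>I\<in>Pow ?D. (-1) ^ card K * X I K)"
    by (rule sum.swap)
  also have "\<dots> = \<sigma> (assoc_product U C d u g f)"
    unfolding canonical_supertrace_def matrix_coeffs_assoc_product[OF g f] F_def[symmetric] G_def[symmetric]
  proof (rule sum.cong[OF refl])
    fix K
    have "formal_integral lborel U ((G \<odot> F) K K * dens) = (\<Sum>I\<in>Pow ?D. X I K)"
      unfolding star_matrix_mult_def sum_distrib_right X'[symmetric]
      by (intro formal_integral_sum[OF is_lebesgue_lborel U] test_formal_mult_right[OF U _ dens] t)
    then show "(\<Sum>I\<in>Pow ?D. (-1) ^ card K * X I K) = (-1) ^ card K * formal_integral lborel U ((G \<odot> F) K K * dens)"
      by (simp add: sum_distrib_left)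
  qed
  finally show ?thesis .
qed

theorem ex1_berezin_supertrace_density:
  "\<exists>!\<rho>. \<rho> \<in> \<S> \<and> supertrace_density M U C d u \<rho> \<and>
     (\<forall>f\<in>\<S>. super_compact_support U f \<longrightarrow> \<sigma> f = berezin_integral M U d f \<rho>)"
proof -
  obtain \<rho> where \<rho>: "\<rho> \<in> \<S>"
    "\<And>f. f \<in> \<S> \<Longrightarrow> super_compact_support U f \<Longrightarrow> \<sigma> f = berezin_integral M U d f \<rho>"
    using ex_berezin_density by blast
  have "supertrace_density M U C d u \<rho>"
    unfolding supertrace_density_def
  proof (intro ballI allI impI)
    fix f g p q
    assume f: "f \<in> \<S>" and g: "g \<in> \<S>"
      and *: "homogeneous p f \<and> homogeneous q g \<and> (super_compact_support U f \<or> super_compact_support U g)"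
    then have comp: "super_compact_support U f \<or> super_compact_support U g"
      "super_compact_support U g \<or> super_compact_support U f" by blast+
    show "berezin_integral M U d (assoc_product U C d u f g) \<rho>
        = (-1) ^ (p * q) * berezin_integral M U d (assoc_product U C d u g f) \<rho>"
      unfolding \<rho>(2)[OF assoc_product_in_superfuns[OF f g] assoc_product_compact[OF f g comp(1)], symmetric]
        \<rho>(2)[OF assoc_product_in_superfuns[OF g f] assoc_product_compact[OF g f comp(2)], symmetric]
      by (rule canonical_supertrace_supercommutes[OF f g _ _ comp(1)]) (use * in auto)
  qed
  then have sol: "\<rho> \<in> \<S> \<and> supertrace_density M U C d u \<rho> \<and>
     (\<forall>f\<in>\<S>. super_compact_support U f \<longrightarrow> \<sigma> f = berezin_integral M U d f \<rho>)"
    using \<rho> by blast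
  show ?thesis
  proof (rule ex1I, rule sol)
    fix \<rho>' assume \<rho>': "\<rho>' \<in> \<S> \<and> supertrace_density M U C d u \<rho>' \<and>
      (\<forall>f\<in>\<S>. super_compact_support U f \<longrightarrow> \<sigma> f = berezin_integral M U d f \<rho>')"
    show "\<rho>' = \<rho>"
    proof (rule berezin_density_unique)
      fix f assume "f \<in> \<S>" "super_compact_support U f"
      then show "berezin_integral M U d f \<rho>' = berezin_integral M U d f \<rho>"
        using \<rho>' \<rho>(2) by metis
    qed (use \<rho>' \<rho>(1) in auto)
  qed
qed

end

theorem theorem1:
  fixes U :: "(complex^'m::finite) set"
    and C :: "'m cochains"
    and d :: nat
    and u :: "'m superfun"
    and dens :: "'m formal"
    and M :: "(complex^'m) measure"
  assumes "open U"
    and "star_product_sep U C"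
    and "nondegenerate U C"
    and "canonical_trace_density U C dens"
    and "admissible U C d u"
    and "is_lebesgue M"
  shows "\<exists>!\<rho>. \<rho> \<in> superfuns U d \<and> supertrace_density M U C d u \<rho> \<and>
           (\<forall>f\<in>superfuns U d. super_compact_support U f \<longrightarrow>
              canonical_supertrace U C d u dens f = berezin_integral M U d f \<rho>)"
proof -
  note sep = assms(2)[unfolded star_product_sep_def]
  note bidiff = sep[THEN conjunct1, THEN spec]
    and unit = sep[THEN conjunct2, THEN conjunct2, THEN conjunct1]
    and assoc = sep[THEN conjunct2, THEN conjunct2, THEN conjunct2, THEN conjunct1]
  have form: "trace_density_form U C dens" and trace: "trace_property U C dens"
    using assms(4) unfolding canonical_trace_density_def by blast+
  interpret super_star_algebra U C d u dens M
  proof unfold_locales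
    show "dens \<in> formal_funs U"
      by (rule trace_density_in_formal_funs[where C = C, OF assms(1) bidiff assms(3) form])
    show "star U C (formal_one U) f = f" if "f \<in> formal_funs U" for f
      by (rule bspec[OF unit that, THEN conjunct1])
    show "star U C f (formal_one U) = f" if "f \<in> formal_funs U" for f
      by (rule bspec[OF unit that, THEN conjunct2])
    show "star U C (star U C f g) h = star U C f (star U C g h)"
      if "f \<in> formal_funs U" "g \<in> formal_funs U" "h \<in> formal_funs U" for f g h
      by (rule assoc[THEN bspec, OF that(1), THEN bspec, OF that(2), THEN bspec, OF that(3)])
  qed (fact assms(1) bidiff assms(5) trace assms(6))+
  show ?thesis by (rule ex1_berezin_supertrace_density)
qed

end
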